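(* There is a constant $C>0$ such that for every $\tau\in(0,1]$, every $K\ge\tau^{-1/2}$ and every sequence of functions $(u_n)_{n\in\mathbb{Z}}$ on $\mathbb{T}$ with $\|u_n\|_{X^{0,3/8}_\tau}<\infty$, $$\|\Pi_Ku_n\|_{l^4_\tau L^4}\le C\,(K\tau^{1/2})^{1/2}\,\|u_n\|_{X^{0,\frac38}_\tau}.$$
   Context: $\mathbb{T}=\mathbb{R}/2\pi\mathbb{Z}$; $\langle a\rangle=(1+|a|^2)^{1/2}$. For a sequence $(u_n)_{n\in\mathbb{Z}}$ with values in a normed space $X$, $\|u_n\|_{l^p_\tau X}=\big(\tau\sum_{n\in\mathbb{Z}}\|u_n\|_X^p\big)^{1/p}$. Discrete Bourgain spaces: for a sequence $(u_n)_{n\in\mathbb{Z}}$ put $\mathcal{F}_\tau(u_n)(\sigma)=\tau\sum_{m\in\mathbb{Z}}u_me^{im\tau\sigma}$, $\sigma\in[-\pi/\tau,\pi/\tau]$ (a $2\pi/\tau$-periodic function), and $d_\tau(\sigma)=\frac{e^{i\tau\sigma}-1}{\tau}$. With $D_\tau$ the operator $(D_\tau u)_n=\frac{u_{n-1}-u_n}{\tau}$, which has symbol $d_\tau$, define $$\|u_n\|_{X^{s,b}_\tau}=\|e^{-in\tau\partial_x^2}u_n\|_{H^b_\tau H^s}=\big\|\langle D_\tau\rangle^b\langle\partial_x\rangle^s(e^{-in\tau\partial_x^2}u_n)\big\|_{l^2_\tau L^2},$$ where $\langle D_\tau\rangle^b$ and $\langle\partial_x\rangle^s$ are the Fourier multipliers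 $\langle d_\tau(\sigma)\rangle^b$ (in time) and $\langle k\rangle^s$ (in space). Filter: $\chi$ is a fixed smooth nonnegative even function equal to $1$ on $[-1,1]$ and supported in $[-2,2]$; for $L>0$, $\Pi_L$ is the Fourier multiplier in $x$ with symbol $\chi^2(k/L)$, $k\in\mathbb{Z}$. *)

theory Defs
  imports "HOL-Analysis.Analysis"
begin

definition epowr :: "ennreal \<Rightarrow> real \<Rightarrow> ennreal" where
  "epowr a p = (if a = top then top else ennreal (enn2real a powr p))"

definition japanese :: "'a::real_normed_vector \<Rightarrow> real" where
  "japanese a = (1 + (norm a)\<^sup>2) powr (1/2)"


text \<open>Functions on the torus are \<open>2 * pi\<close>-periodic functions on the real line.  Every class of
  Lebesgue measurable functions modulo null sets has a Borel representative.  Norms may be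
  infinite, so they take values in \<^typ>\<open>ennreal\<close>.\<close>

definition torus_fun :: "(real \<Rightarrow> complex) \<Rightarrow> bool" where
  "torus_fun f \<longleftrightarrow> f \<in> borel_measurable borel \<and> (\<forall>x. f (x + 2 * pi) = f x)"

definition Lp_norm :: "real \<Rightarrow> (real \<Rightarrow> complex) \<Rightarrow> ennreal" where
  "Lp_norm p f = epowr (\<integral>\<^sup>+x\<in>{-pi..pi}. ennreal (norm (f x) powr p) \<partial>lborel) (1 / p)"

definition torus_L2 :: "(real \<Rightarrow> complex) \<Rightarrow> bool" where
  "torus_L2 f \<longleftrightarrow> torus_fun f \<and> Lp_norm 2 f < top"

definition lp_norm :: "real \<Rightarrow> real \<Rightarrow> (int \<Rightarrow> ennreal) \<Rightarrow> ennreal" where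
  "lp_norm \<tau> p a = epowr (ennreal \<tau> * (\<Sum>\<^sub>\<infinity>n. epowr (a n) p)) (1 / p)"

definition fourier_coeff :: "(real \<Rightarrow> complex) \<Rightarrow> int \<Rightarrow> complex" where
  "fourier_coeff f k =
     (LINT x:{-pi..pi}|lborel. f x * exp (- (\<i> * of_int k * of_real x))) / (2 * of_real pi)"

text \<open>The two multiplier predicates determine the second function (respectively sequence of
  functions) up to null sets.\<close>

definition space_multiplier ::
    "(int \<Rightarrow> complex) \<Rightarrow> (real \<Rightarrow> complex) \<Rightarrow> (real \<Rightarrow> complex) \<Rightarrow> bool" where
  "space_multiplier m f g \<longleftrightarrow> torus_L2 f \<and> torus_L2 g \<and>
     (\<forall>k. fourier_coeff g k = m k * fourier_coeff f k)"

text \<open>The series \<open>F \<sigma> = \<tau> * (\<Sum>m. exp (\<i> * m * \<tau> * \<sigma>) * u m)\<close>, with values in \<open>L\<^sup>2\<close> of the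
  torus, is understood as a limit in \<open>L\<^sup>2\<close> in \<open>\<sigma>\<close>; it converges if and only if
  \<open>(u m)\<close> is square summable.\<close>

definition has_time_fourier ::
    "real \<Rightarrow> (int \<Rightarrow> real \<Rightarrow> complex) \<Rightarrow> (real \<Rightarrow> real \<Rightarrow> complex) \<Rightarrow> bool" where
  "has_time_fourier \<tau> u F \<longleftrightarrow>
     (\<forall>m. torus_L2 (u m)) \<and> case_prod F \<in> borel_measurable (lborel \<Otimes>\<^sub>M lborel) \<and>
     ((\<lambda>N::nat. \<integral>\<^sup>+\<sigma>\<in>{-pi/\<tau>..pi/\<tau>}. (\<integral>\<^sup>+x\<in>{-pi..pi}.
         ennreal ((norm (F \<sigma> x
           - of_real \<tau> * (\<Sum>m=-int N..int N. u m x * exp (\<i> * of_int m * of_real \<tau> * of_real \<sigma>))))\<^sup>2)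
         \<partial>lborel) \<partial>lborel) \<longlonglongrightarrow> 0)"

definition time_multiplier ::
    "real \<Rightarrow> (real \<Rightarrow> complex) \<Rightarrow> (int \<Rightarrow> real \<Rightarrow> complex) \<Rightarrow> (int \<Rightarrow> real \<Rightarrow> complex) \<Rightarrow> bool" where
  "time_multiplier \<tau> m u w \<longleftrightarrow>
     (\<exists>F. has_time_fourier \<tau> u F \<and> has_time_fourier \<tau> w (\<lambda>\<sigma> x. m \<sigma> * F \<sigma> x))"

text \<open>The symbol of \<open>(D u) n = (u (n - 1) - u n) / \<tau>\<close>.\<close>

definition d_sym :: "real \<Rightarrow> real \<Rightarrow> complex" where
  "d_sym \<tau> \<sigma> = (exp (\<i> * of_real \<tau> * of_real \<sigma>) - 1) / of_real \<tau>"

text \<open>\<open>bourgain_image \<tau> s b u w\<close> says that \<open>w\<close> is the sequence whose \<open>l\<^sup>2 L\<^sup>2\<close> norm is the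
  discrete Bourgain norm of \<open>u\<close>: \<open>v n = exp(-i n \<tau> \<partial>\<^sub>x\<^sup>2) (u n)\<close> (symbol \<open>exp(i n \<tau> k\<^sup>2)\<close>, as
  \<open>\<partial>\<^sub>x\<^sup>2\<close> has symbol \<open>- k\<^sup>2\<close>), then the spatial weight is applied, then the temporal one.  The norm is
  infinite if there is no such \<open>w\<close>.  As the \<open>u n\<close> are functions in \<open>L\<^sup>2\<close>, the definition is meant
  for \<open>s \<ge> 0\<close>; for negative \<open>s\<close> it does not cover distributions outside \<open>L\<^sup>2\<close>.\<close>

definition bourgain_image ::
    "real \<Rightarrow> real \<Rightarrow> real \<Rightarrow> (int \<Rightarrow> real \<Rightarrow> complex) \<Rightarrow> (int \<Rightarrow> real \<Rightarrow> complex) \<Rightarrow> bool" where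
  "bourgain_image \<tau> s b u w \<longleftrightarrow>
     (\<exists>v v'. (\<forall>n. space_multiplier (\<lambda>k. exp (\<i> * of_int n * of_real \<tau> * (of_int k)\<^sup>2)) (u n) (v n)) \<and>
             (\<forall>n. space_multiplier (\<lambda>k. of_real (japanese (real_of_int k) powr s)) (v n) (v' n)) \<and>
             time_multiplier \<tau> (\<lambda>\<sigma>. of_real (japanese (d_sym \<tau> \<sigma>) powr b)) v' w)"

definition bourgain_norm :: "real \<Rightarrow> real \<Rightarrow> real \<Rightarrow> (int \<Rightarrow> real \<Rightarrow> complex) \<Rightarrow> ennreal" where
  "bourgain_norm \<tau> s b u =
     (if \<exists>w. bourgain_image \<tau> s b u w
      then lp_norm \<tau> 2 (\<lambda>n. Lp_norm 2 ((SOME w. bourgain_image \<tau> s b u w) n))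
      else top)"

definition cutoff :: "(real \<Rightarrow> real) \<Rightarrow> bool" where
  "cutoff chi \<longleftrightarrow>
     (\<forall>n. (deriv ^^ n) chi differentiable_on UNIV) \<and> (\<forall>x. chi x \<ge> 0) \<and> (\<forall>x. chi (- x) = chi x) \<and>
     (\<forall>x\<in>{-1..1}. chi x = 1) \<and> (\<forall>x. x \<notin> {-2..2} \<longrightarrow> chi x = 0)"

text \<open>For a cutoff function and \<open>L > 0\<close> only finitely many terms of the sum are nonzero.\<close>

definition freq_filter :: "(real \<Rightarrow> real) \<Rightarrow> real \<Rightarrow> (real \<Rightarrow> complex) \<Rightarrow> real \<Rightarrow> complex" where
  "freq_filter chi L f x =
     (\<Sum>\<^sub>\<infinity>k::int. of_real ((chi (of_int k / L))\<^sup>2) * fourier_coeff f k * exp (\<i> * of_int k * of_real x))"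

end

theory Submission
  imports Defs
begin

text \<open>By Plancherel's theorem, as the fourth power of an \<open>L\<^sup>4\<close> norm is the squared \<open>L\<^sup>2\<close> norm of a
square, the estimate is about the convolution square of the space-time Fourier transform of
\<open>u\<close>.  In the variable \<open>s\<close> dual to time, the weight \<open>\<langle>d(s - k\<^sup>2)\<rangle>\<close> compares with one plus the
distance of \<open>s - k\<^sup>2\<close> to the lattice \<open>(2 \<pi> / \<tau>) \<int>\<close>.  Split \<open>u\<close> into pieces \<open>u\<^sub>i\<close> on which this weight is of
size \<open>2\<^sup>i\<close>.  For \<open>i \<le> j\<close>, Cauchy-Schwarz bounds \<open>\<parallel>u\<^sub>i u\<^sub>j\<parallel>\<^sup>2\<close> by \<open>\<parallel>u\<^sub>i\<parallel>\<^sup>2 \<parallel>u\<^sub>j\<parallel>\<^sup>2\<close> times the largest measure of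
the set of ways to write a space-time frequency as a sum of one frequency from either piece.  The spatial
frequency \<open>k\<^sub>1\<close> of the first summand satisfies \<open>\<bar>k\<^sub>1\<bar> \<le> 2 K\<close> and is such that
\<open>k\<^sub>1\<^sup>2 + (k - k\<^sub>1)\<^sup>2\<close> lies within \<open>O(2\<^sup>j)\<close> of a translate of the lattice; as this quantity is at
most \<open>8 K\<^sup>2\<close>, about \<open>K\<^sup>2 \<tau>\<close> lattice points are involved, and a quadratic polynomial enters an interval of
length \<open>2\<^sup>j\<close> at \<open>O(2\<^bsup>j/2\<^esup>)\<close> integers.  Once \<open>k\<^sub>1\<close> is fixed, the first time frequency ranges over a set of
measure \<open>O(2\<^sup>i)\<close>.  Altogether
\<open>\<parallel>u\<^sub>i u\<^sub>j\<parallel> \<lesssim> K \<tau>\<^bsup>1/2\<^esup> 2\<^bsup>i/2\<^esup> 2\<^bsup>j/4\<^esup> \<parallel>u\<^sub>i\<parallel> \<parallel>u\<^sub>j\<parallel>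
= K \<tau>\<^bsup>1/2\<^esup> 2\<^bsup>-(j-i)/8\<^esup> (2\<^bsup>3i/8\<^esup> \<parallel>u\<^sub>i\<parallel>) (2\<^bsup>3j/8\<^esup> \<parallel>u\<^sub>j\<parallel>)\<close>,
and the geometric factor makes the sum over \<open>i\<close> and \<open>j\<close> converge.  The exponent \<open>3/8\<close> is exactly what
the two powers \<open>1/2\<close> and \<open>1/4\<close> average to, and the lattice count is what costs the
factor \<open>K \<tau>\<^bsup>1/2\<^esup>\<close>.

The convolution argument is carried out on a finite grid of time frequencies, where it is a statement about finite
sums: \<open>dyadic_bilinear\<close> is the summation over dyadic pieces, \<open>card_convolution_fibre_le\<close> the
counting, and \<open>grid_strichartz\<close> their combination through Plancherel.  A sequence that is supported on
finitely many times has a trigonometric polynomial as its Fourier transform, and this is recovered exactly from a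
sufficiently fine grid.  An averaging argument chooses the position of the grid such that the weighted grid sum
does not exceed the weighted integral; this gives \<open>truncated_strichartz\<close>.

A general sequence is truncated to times \<open>\<bar>n\<bar> \<le> N\<close>.  For fixed \<open>\<tau>\<close> the weight is bounded, so the weighted norms of
the truncations are controlled, up to an error that vanishes as \<open>N\<close> grows, by the norm of the weighted
sequence.  This is \<open>eventually_energy_le\<close>; it uses only Bessel's inequality in space and orthogonality in time.\<close>

section \<open>Summation over dyadic pieces\<close>

lemma L2_set_sum_le:
  assumes "finite A"
  shows "L2_set (\<lambda>q. \<Sum>i\<in>A. f i q) Q \<le> (\<Sum>i\<in>A. L2_set (f i) Q)"
  using assms
proof (induction A rule: finite_induct)
  case empty
  then show ?case by (simp add: L2_set_def)
next
  case (insert i A)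
  have "L2_set (\<lambda>q. f i q + (\<Sum>i\<in>A. f i q)) Q \<le> L2_set (f i) Q + L2_set (\<lambda>q. \<Sum>i\<in>A. f i q) Q"
    by (rule L2_set_triangle_ineq)
  with insert show ?case by simp
qed

lemma sum_power_abs_diff_le:
  fixes r :: real
  assumes "0 \<le> r" "r < 1"
  shows "(\<Sum>j<n. r ^ (max i j - min i j)) \<le> 2 / (1 - r)"
proof -
  have geo: "(\<Sum>m\<in>M. r ^ m) \<le> 1 / (1 - r)" if "finite M" for M
  proof -
    have "(\<Sum>m\<in>M. r ^ m) \<le> (\<Sum>m. r ^ m)"
      by (rule sum_le_suminf) (use assms that in \<open>auto intro!: summable_geometric\<close>)
    then show ?thesis using assms by (simp add: suminf_geometric)
  qed
  have "(\<Sum>j<n. r ^ (max i j - min i j))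
      \<le> (\<Sum>j\<in>{..<n} \<inter> {..i}. r ^ (i - j)) + (\<Sum>j\<in>{..<n} - {..i}. r ^ (j - i))"
    by (subst sum.Int_Diff[where B = "{..i}"]) (auto intro!: add_mono sum_mono simp: max_def min_def)
  also have "(\<Sum>j\<in>{..<n} \<inter> {..i}. r ^ (i - j)) = (\<Sum>m\<in>(\<lambda>j. i - j) ` ({..<n} \<inter> {..i}). r ^ m)"
    by (subst sum.reindex) (auto simp: inj_on_def)
  also have "(\<Sum>j\<in>{..<n} - {..i}. r ^ (j - i)) = (\<Sum>m\<in>(\<lambda>j. j - i) ` ({..<n} - {..i}). r ^ m)"
    by (subst sum.reindex) (auto simp: inj_on_def)
  finally show ?thesis
    using geo[of "(\<lambda>j. i - j) ` ({..<n} \<inter> {..i})"] geo[of "(\<lambda>j. j - i) ` ({..<n} - {..i})"] by simp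
qed

text \<open>The Schur test for a symmetric nonnegative kernel, in quadratic form: \<open>e\<^sub>i e\<^sub>j\<close> is at most the mean of the two
squares, and by symmetry both squares contribute the same row sums.\<close>

lemma sum_swap_weight_le:
  fixes c :: "nat \<Rightarrow> nat \<Rightarrow> real" and e :: "nat \<Rightarrow> real"
  assumes sym: "\<And>i j. c i j = c j i" and nonneg: "\<And>i j. 0 \<le> c i j"
    and row: "\<And>i. (\<Sum>j<n. c i j) \<le> B"
  shows "(\<Sum>i<n. \<Sum>j<n. c i j * (e i * e j)) \<le> B * (\<Sum>i<n. (e i)\<^sup>2)"
proof -
  have "(\<Sum>i<n. \<Sum>j<n. c i j * (e i * e j)) \<le> (\<Sum>i<n. \<Sum>j<n. c i j * (e i)\<^sup>2 / 2 + c i j * (e j)\<^sup>2 / 2)"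
  proof (intro sum_mono)
    fix i j
    have "e i * e j \<le> ((e i)\<^sup>2 + (e j)\<^sup>2) / 2"
      using sum_squares_bound[of "e i" "e j"] by simp
    from mult_left_mono[OF this nonneg[of i j]]
    show "c i j * (e i * e j) \<le> c i j * (e i)\<^sup>2 / 2 + c i j * (e j)\<^sup>2 / 2"
      by (simp add: algebra_simps add_divide_distrib)
  qed
  also have "\<dots> = (\<Sum>i<n. \<Sum>j<n. c i j * (e i)\<^sup>2 / 2) + (\<Sum>i<n. \<Sum>j<n. c i j * (e j)\<^sup>2 / 2)"
    by (simp add: sum.distrib)
  also have "(\<Sum>i<n. \<Sum>j<n. c i j * (e j)\<^sup>2 / 2) = (\<Sum>i<n. \<Sum>j<n. c i j * (e i)\<^sup>2 / 2)"
    by (subst sum.swap) (simp add: sym)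
  also have "(\<Sum>i<n. \<Sum>j<n. c i j * (e i)\<^sup>2 / 2) + (\<Sum>i<n. \<Sum>j<n. c i j * (e i)\<^sup>2 / 2)
      = (\<Sum>i<n. (\<Sum>j<n. c i j) * (e i)\<^sup>2)"
    by (simp add: sum_distrib_right flip: sum.distrib)
  also have "\<dots> \<le> (\<Sum>i<n. B * (e i)\<^sup>2)"
    by (intro sum_mono mult_right_mono row) auto
  finally show ?thesis by (simp add: sum_distrib_left)
qed

text \<open>The sum over \<open>q\<close> of the squared convolution coefficients is a squared \<open>\<ell>\<^sup>2\<close> norm, so the pieces with levels
\<open>(i, j)\<close> are treated one by one and added by the triangle inequality.  Cauchy-Schwarz on the fibres of \<open>add\<close> costs
\<open>R 2\<^bsup>min i j\<^esup> 2\<^bsup>max i j / 2\<^esup>\<close>.  Since \<open>min i j + max i j / 2 = 3/4 i + 3/4 j - \<bar>i - j\<bar>/4\<close>, after each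
piece has been given the weight \<open>2\<^bsup>3i/4\<^esup>\<close> there remains a factor that decays
geometrically in \<open>\<bar>i - j\<bar>\<close>, and the Schur test applies.\<close>

lemma dyadic_bilinear:
  fixes a :: "'p \<Rightarrow> real" and lev :: "'p \<Rightarrow> nat" and add :: "'p \<Rightarrow> 'p \<Rightarrow> 'q" and R :: real
  assumes S: "finite S" and Q: "finite Q" and R: "0 \<le> R"
    and add: "\<And>x y. x \<in> S \<Longrightarrow> y \<in> S \<Longrightarrow> add x y \<in> Q"
    and count: "\<And>i j q. q \<in> Q \<Longrightarrow>
      real (card {(x, y). x \<in> S \<and> y \<in> S \<and> lev x = i \<and> lev y = j \<and> add x y = q})
        \<le> R * 2 ^ min i j * 2 powr (real (max i j) / 2)"
  shows "(\<Sum>q\<in>Q. (\<Sum>(x, y) | x \<in> S \<and> y \<in> S \<and> add x y = q. a x * a y)\<^sup>2)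
    \<le> (2 / (1 - 2 powr (- 1/8)))\<^sup>2 * R * (\<Sum>x\<in>S. 2 powr (3/4 * real (lev x)) * (a x)\<^sup>2)\<^sup>2"
proof -
  define r :: real where "r = 2 powr (- 1/8)"
  have r: "0 \<le> r" "r < 1" by (auto simp: r_def powr_less_one)
  define T where "T i j q = {(x, y). x \<in> S \<and> y \<in> S \<and> lev x = i \<and> lev y = j \<and> add x y = q}" for i j q
  define h where "h i j q = (\<Sum>(x, y)\<in>T i j q. a x * a y)" for i j q
  define Sl where "Sl i = {x \<in> S. lev x = i}" for i
  define m where "m i = (\<Sum>x\<in>Sl i. (a x)\<^sup>2)" for i
  define e where "e i = sqrt (2 powr (3/4 * real i) * m i)" for i
  have finT: "finite (T i j q)" for i j q
    by (rule finite_subset[of _ "S \<times> S"]) (use S in \<open>auto simp: T_def\<close>)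
  have finSl: "finite (Sl i)" for i using S by (auto simp: Sl_def)
  have m0: "0 \<le> m i" for i by (auto simp: m_def intro!: sum_nonneg)
  obtain n where n: "\<And>x. x \<in> S \<Longrightarrow> lev x < n"
    using S by (metis finite_imageI finite_nat_set_iff_bounded image_eqI)
  have split: "(\<Sum>(x, y) | x \<in> S \<and> y \<in> S \<and> add x y = q. a x * a y)
      = (\<Sum>ij\<in>{..<n}\<times>{..<n}. h (fst ij) (snd ij) q)" for q
  proof -
    have "(\<Sum>ij\<in>{..<n}\<times>{..<n}. sum (\<lambda>(x, y). a x * a y)
        {z \<in> {(x, y). x \<in> S \<and> y \<in> S \<and> add x y = q}. (lev (fst z), lev (snd z)) = ij})
      = sum (\<lambda>(x, y). a x * a y) {(x, y). x \<in> S \<and> y \<in> S \<and> add x y = q}"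
    proof (rule sum.group)
      show "finite {(x, y). x \<in> S \<and> y \<in> S \<and> add x y = q}"
        by (rule finite_subset[of _ "S \<times> S"]) (use S in auto)
    qed (use n in auto)
    moreover have "{z \<in> {(x, y). x \<in> S \<and> y \<in> S \<and> add x y = q}. (lev (fst z), lev (snd z)) = ij}
       = T (fst ij) (snd ij) q" for ij
      by (auto simp: T_def)
    ultimately show ?thesis by (simp add: h_def)
  qed
  have piece: "L2_set (h i j) Q \<le> sqrt R * (r ^ (max i j - min i j) * (e i * e j))" for i j
  proof -
    define c where "c = R * 2 ^ min i j * 2 powr (real (max i j) / 2)"
    have c0: "0 \<le> c" using R by (auto simp: c_def)
    have sq: "(h i j q)\<^sup>2 \<le> c * (\<Sum>(x, y)\<in>T i j q. (a x)\<^sup>2 * (a y)\<^sup>2)" if "q \<in> Q" for q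
    proof -
      have "(h i j q)\<^sup>2 \<le> (\<Sum>z\<in>T i j q. 1\<^sup>2) * (\<Sum>z\<in>T i j q. (a (fst z) * a (snd z))\<^sup>2)"
        using Cauchy_Schwarz_ineq_sum[of "\<lambda>_. 1" "\<lambda>z. a (fst z) * a (snd z)" "T i j q"]
        by (simp add: h_def case_prod_unfold)
      also have "\<dots> \<le> c * (\<Sum>z\<in>T i j q. (a (fst z) * a (snd z))\<^sup>2)"
        using count[OF that, of i j] by (intro mult_right_mono) (auto simp: c_def T_def intro!: sum_nonneg)
      finally show ?thesis by (simp add: case_prod_unfold power_mult_distrib)
    qed
    have "(\<Sum>q\<in>Q. (h i j q)\<^sup>2) \<le> (\<Sum>q\<in>Q. c * (\<Sum>(x, y)\<in>T i j q. (a x)\<^sup>2 * (a y)\<^sup>2))"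
      by (intro sum_mono sq)
    also have "\<dots> = c * (\<Sum>q\<in>Q. \<Sum>(x, y)\<in>T i j q. (a x)\<^sup>2 * (a y)\<^sup>2)"
      by (simp add: sum_distrib_left)
    also have "(\<Sum>q\<in>Q. \<Sum>(x, y)\<in>T i j q. (a x)\<^sup>2 * (a y)\<^sup>2)
       = (\<Sum>(x, y)\<in>Sl i \<times> Sl j. (a x)\<^sup>2 * (a y)\<^sup>2)"
    proof -
      have "(\<Sum>q\<in>Q. sum (\<lambda>(x, y). (a x)\<^sup>2 * (a y)\<^sup>2) {z \<in> Sl i \<times> Sl j. add (fst z) (snd z) = q})
        = sum (\<lambda>(x, y). (a x)\<^sup>2 * (a y)\<^sup>2) (Sl i \<times> Sl j)"
        by (rule sum.group) (use finSl Q add in \<open>auto simp: Sl_def\<close>)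
      moreover have "{z \<in> Sl i \<times> Sl j. add (fst z) (snd z) = q} = T i j q" for q
        by (auto simp: Sl_def T_def)
      ultimately show ?thesis by simp
    qed
    also have "\<dots> = m i * m j"
      by (simp add: m_def sum_product sum.cartesian_product)
    also have "c * (m i * m j) = (sqrt R * (r ^ (max i j - min i j) * (e i * e j)))\<^sup>2"
    proof -
      have rp: "r ^ k = 2 powr (- real k / 8)" for k
        by (simp add: r_def powr_realpow[symmetric] powr_powr)
      have tp: "(2::real) ^ k = 2 powr (real k)" for k
        by (simp add: powr_realpow)
      have ee: "(e k)\<^sup>2 = 2 powr (3/4 * real k) * m k" for k
        using m0 by (simp add: e_def)
      have rr: "(r ^ k)\<^sup>2 = 2 powr (- real k / 4)" for k
        unfolding rp by (simp add: power2_eq_square powr_add[symmetric])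
      have "(sqrt R * (r ^ (max i j - min i j) * (e i * e j)))\<^sup>2
          = R * (2 powr (- real (max i j - min i j) / 4) * ((2 powr (3/4 * real i) * m i) * (2 powr (3/4 * real j) * m j)))"
        using R by (simp only: power_mult_distrib ee rr real_sqrt_pow2)
      also have "\<dots> = R * (2 powr (- real (max i j - min i j) / 4) * 2 powr (3/4 * real i) * 2 powr (3/4 * real j)) * (m i * m j)"
        by (simp add: mult_ac)
      also have "2 powr (- real (max i j - min i j) / 4) * 2 powr (3/4 * real i) * 2 powr (3/4 * real j)
          = 2 powr (real (min i j)) * 2 powr (real (max i j) / 2)"
      proof -
        have "- real (max i j - min i j) / 4 + 3/4 * real i + 3/4 * real j = real (min i j) + real (max i j) / 2"
          by (cases "i \<le> j") (simp_all add: max_def min_def of_nat_diff field_simps)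
        then show ?thesis by (simp only: powr_add[symmetric])
      qed
      finally show ?thesis by (simp add: c_def tp)
    qed
    finally have "(\<Sum>q\<in>Q. (h i j q)\<^sup>2) \<le> (sqrt R * (r ^ (max i j - min i j) * (e i * e j)))\<^sup>2" .
    moreover have "0 \<le> e k" for k using m0 by (simp add: e_def)
    then have "0 \<le> sqrt R * (r ^ (max i j - min i j) * (e i * e j))"
      using R r by simp
    ultimately show ?thesis unfolding L2_set_def by (rule real_le_lsqrt[rotated])
  qed
  have "L2_set (\<lambda>q. \<Sum>(x, y) | x \<in> S \<and> y \<in> S \<and> add x y = q. a x * a y) Q
      \<le> (\<Sum>ij\<in>{..<n}\<times>{..<n}. L2_set (h (fst ij) (snd ij)) Q)"
    unfolding split by (rule L2_set_sum_le) auto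
  also have "\<dots> \<le> (\<Sum>ij\<in>{..<n}\<times>{..<n}. sqrt R * (r ^ (max (fst ij) (snd ij) - min (fst ij) (snd ij)) * (e (fst ij) * e (snd ij))))"
    by (intro sum_mono piece)
  also have "\<dots> = sqrt R * (\<Sum>i<n. \<Sum>j<n. r ^ (max i j - min i j) * (e i * e j))"
    by (simp add: sum_distrib_left sum.cartesian_product case_prod_unfold)
  also have "\<dots> \<le> sqrt R * (2 / (1 - r) * (\<Sum>i<n. (e i)\<^sup>2))"
    using R r by (intro mult_left_mono sum_swap_weight_le sum_power_abs_diff_le)
      (auto simp: max.commute min.commute)
  also have "(\<Sum>i<n. (e i)\<^sup>2) = (\<Sum>x\<in>S. 2 powr (3/4 * real (lev x)) * (a x)\<^sup>2)"
  proof -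
    have "(\<Sum>i<n. (e i)\<^sup>2) = (\<Sum>i<n. \<Sum>x\<in>{x\<in>S. lev x = i}. 2 powr (3/4 * real (lev x)) * (a x)\<^sup>2)"
    proof (rule sum.cong[OF refl])
      fix i
      have "(e i)\<^sup>2 = 2 powr (3/4 * real i) * m i" using m0 by (simp add: e_def)
      also have "\<dots> = (\<Sum>x\<in>{x\<in>S. lev x = i}. 2 powr (3/4 * real (lev x)) * (a x)\<^sup>2)"
        by (simp add: m_def Sl_def sum_distrib_left)
      finally show "(e i)\<^sup>2 = (\<Sum>x\<in>{x\<in>S. lev x = i}. 2 powr (3/4 * real (lev x)) * (a x)\<^sup>2)" .
    qed
    also have "\<dots> = (\<Sum>x\<in>S. 2 powr (3/4 * real (lev x)) * (a x)\<^sup>2)"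
      by (rule sum.group) (use S n in auto)
    finally show ?thesis .
  qed
  finally have "(L2_set (\<lambda>q. \<Sum>(x, y) | x \<in> S \<and> y \<in> S \<and> add x y = q. a x * a y) Q)\<^sup>2
     \<le> (sqrt R * (2 / (1 - r) * (\<Sum>x\<in>S. 2 powr (3/4 * real (lev x)) * (a x)\<^sup>2)))\<^sup>2"
    by (intro power_mono) auto
  also have "\<dots> = (2 / (1 - r))\<^sup>2 * R * (\<Sum>x\<in>S. 2 powr (3/4 * real (lev x)) * (a x)\<^sup>2)\<^sup>2"
    using R by (simp only: power_mult_distrib real_sqrt_pow2 mult_ac)
  finally show ?thesis
    by (simp only: L2_set_def real_sqrt_pow2 sum_nonneg zero_le_power2 r_def)
qed

section \<open>Counting resonant frequencies\<close>

text \<open>The sine is concave on \<open>[0, \<pi>]\<close>, hence lies above its chord on \<open>[0, \<pi>/2]\<close>.\<close>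

lemma sin_ge_chord:
  assumes "0 \<le> x" "x \<le> pi / 2"
  shows "2 * x / pi \<le> sin x"
proof -
  have conc: "concave_on {0..pi} sin"
  proof (rule f''_le0_imp_concave)
    show "convex {0..pi}" by simp
    show "(sin has_real_derivative cos x) (at x)" for x :: real
      by (auto intro!: derivative_eq_intros)
    show "(cos has_real_derivative - sin x) (at x)" for x :: real
      by (auto intro!: derivative_eq_intros)
    show "- sin x \<le> 0" if "x \<in> {0..pi}" for x :: real
      using that sin_ge_zero by auto
  qed
  define t where "t = 2 * x / pi"
  have t: "0 \<le> t" "t \<le> 1" using assms by (auto simp: t_def field_simps)
  have "(1 - t) * sin 0 + t * sin (pi / 2) \<le> sin ((1 - t) *\<^sub>R 0 + t *\<^sub>R (pi / 2))"
    by (rule concave_onD[OF conc t]) auto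
  then show ?thesis by (simp add: t_def)
qed

text \<open>The modulus of \<open>d_sym \<tau> \<sigma>\<close> is \<open>2 \<bar>sin (\<tau> \<sigma> / 2)\<bar> / \<tau>\<close>, which by concavity of the sine is at least \<open>2/\<pi>\<close> times
the distance of \<open>\<sigma>\<close> to the nearest period.\<close>

lemma d_sym_small_imp_near_period:
  assumes "0 < \<tau>" "norm (d_sym \<tau> \<sigma>) \<le> M"
  shows "\<exists>z::int. \<bar>\<sigma> - 2 * pi * of_int z / \<tau>\<bar> \<le> pi / 2 * M"
proof -
  define z where "z = round (\<tau> * \<sigma> / (2 * pi))"
  define y where "y = \<tau> * \<sigma> / 2 - pi * of_int z"
  have "\<bar>of_int z - \<tau> * \<sigma> / (2 * pi)\<bar> \<le> 1 / 2"
    unfolding z_def by (rule of_int_round_abs_le)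
  then have "\<bar>y\<bar> \<le> pi / 2"
    by (simp add: y_def abs_le_iff field_simps)
  have y2: "\<tau> * \<sigma> = 2 * y + 2 * pi * of_int z" by (simp add: y_def)
  have "cis (\<tau> * \<sigma>) = cis (2 * y)"
    unfolding y2 cis_mult[symmetric] by simp
  then have "norm (d_sym \<tau> \<sigma>) = norm (cis (2 * y) - 1) / \<tau>"
    using assms(1) by (simp add: d_sym_def cis_conv_exp norm_divide mult.assoc)
  also have "norm (cis (2 * y) - 1) = 2 * \<bar>sin y\<bar>"
  proof -
    have "cis (2 * y) - 1 = cis y * (2 * \<i> * sin y)"
      using cos_double_sin[of y] sin_double[of y]
      by (intro complex_eqI) (simp_all add: power2_eq_square)
    then show ?thesis by (simp add: norm_mult)
  qed
  finally have n: "norm (d_sym \<tau> \<sigma>) = 2 * \<bar>sin y\<bar> / \<tau>" .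
  have "2 * \<bar>y\<bar> / pi \<le> sin \<bar>y\<bar>"
    using \<open>\<bar>y\<bar> \<le> pi / 2\<close> by (intro sin_ge_chord) auto
  also have "\<dots> \<le> \<bar>sin y\<bar>" by (simp add: abs_if split: if_splits)
  finally have "2 * \<bar>y\<bar> / pi \<le> \<bar>sin y\<bar>" .
  then have "2 * \<bar>y\<bar> / \<tau> \<le> pi / 2 * (2 * \<bar>sin y\<bar> / \<tau>)"
    using assms(1) by (simp add: field_simps)
  also have "\<dots> \<le> pi / 2 * M"
    using assms(2) n by (intro mult_left_mono) auto
  also have "2 * \<bar>y\<bar> / \<tau> = \<bar>\<sigma> - 2 * pi * of_int z / \<tau>\<bar>"
  proof -
    have "\<sigma> - 2 * pi * of_int z / \<tau> = 2 * y / \<tau>"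
      using assms(1) by (simp add: y_def field_simps)
    then show ?thesis using assms(1) by (simp add: abs_mult)
  qed
  finally show ?thesis by blast
qed

lemma card_int_close_le:
  fixes c \<rho> :: real
  assumes "0 \<le> \<rho>"
  shows "finite {t::int. \<bar>of_int t - c\<bar> \<le> \<rho>}"
    and "real (card {t::int. \<bar>of_int t - c\<bar> \<le> \<rho>}) \<le> 2 * \<rho> + 1"
proof -
  have eq: "{t::int. \<bar>of_int t - c\<bar> \<le> \<rho>} = {\<lceil>c - \<rho>\<rceil>..\<lfloor>c + \<rho>\<rfloor>}"
    by (auto simp: abs_le_iff ceiling_le_iff le_floor_iff)
  show "finite {t::int. \<bar>of_int t - c\<bar> \<le> \<rho>}" by (simp add: eq)
  have "real_of_int (\<lfloor>c + \<rho>\<rfloor> - \<lceil>c - \<rho>\<rceil>) \<le> 2 * \<rho>"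
    using of_int_floor_le[of "c + \<rho>"] le_of_int_ceiling[of "c - \<rho>"] unfolding of_int_diff by linarith
  then show "real (card {t::int. \<bar>of_int t - c\<bar> \<le> \<rho>}) \<le> 2 * \<rho> + 1"
    using assms by (cases "0 \<le> \<lfloor>c + \<rho>\<rfloor> - \<lceil>c - \<rho>\<rceil> + 1") (auto simp: eq)
qed

text \<open>For nonnegative \<open>t \<ge> t'\<close> one has \<open>(t - t')\<^sup>2 \<le> t\<^sup>2 - t'\<^sup>2\<close>, so integers whose squares lie in an
interval of length \<open>2 r\<close> lie, on either side of the origin, in an interval of length \<open>sqrt (2 * r)\<close>.\<close>

lemma card_int_square_close_le:
  fixes a r :: real
  assumes "0 \<le> r"
  shows "finite {t::int. \<bar>(of_int t)\<^sup>2 - a\<bar> \<le> r}"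
    and "real (card {t::int. \<bar>(of_int t)\<^sup>2 - a\<bar> \<le> r}) \<le> 2 * sqrt (2 * r) + 2"
proof -
  define X where "X = {t::int. \<bar>(of_int t)\<^sup>2 - a\<bar> \<le> r}"
  define Y where "Y = {t \<in> X. 0 \<le> t}"
  have bd: "\<bar>of_int t\<bar> \<le> \<bar>a\<bar> + r" if "t \<in> X" for t :: int
  proof -
    have "\<bar>t\<bar> \<le> t\<^sup>2"
      using self_le_power[of "\<bar>t\<bar>" 2] by (cases "t = 0") auto
    then have "\<bar>real_of_int t\<bar> \<le> (real_of_int t)\<^sup>2"
      by (metis of_int_abs of_int_le_iff of_int_power)
    with that show ?thesis by (auto simp: X_def)
  qed
  show fin: "finite {t::int. \<bar>(of_int t)\<^sup>2 - a\<bar> \<le> r}"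
  proof -
    have "X \<subseteq> {t. \<bar>of_int t - 0\<bar> \<le> \<bar>a\<bar> + r}" using bd by auto
    then have "finite X" by (rule finite_subset) (rule card_int_close_le(1), use assms in auto)
    then show ?thesis by (simp add: X_def)
  qed
  have finY: "finite Y" using fin by (auto simp: Y_def X_def)
  have cardY: "real (card Y) \<le> sqrt (2 * r) + 1"
  proof (cases "Y = {}")
    case False
    define t0 where "t0 = Min Y"
    have t0: "t0 \<in> Y" using False finY by (simp add: t0_def)
    have "Y \<subseteq> {t. \<bar>of_int t - (of_int t0 + sqrt (2 * r) / 2)\<bar> \<le> sqrt (2 * r) / 2}"
    proof
      fix t assume t: "t \<in> Y"
      have le: "t0 \<le> t" using t finY by (simp add: t0_def)
      have "(real_of_int t - of_int t0)\<^sup>2 \<le> (real_of_int t)\<^sup>2 - (of_int t0)\<^sup>2"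
        using le t0 mult_left_mono[of "real_of_int t0" "real_of_int t" "2 * real_of_int t0"]
        by (auto simp: Y_def power2_eq_square algebra_simps)
      also have "\<dots> \<le> 2 * r" using t t0 by (auto simp: Y_def X_def)
      finally have "real_of_int t - of_int t0 \<le> sqrt (2 * r)"
        by (rule real_le_rsqrt)
      then show "t \<in> {t. \<bar>of_int t - (of_int t0 + sqrt (2 * r) / 2)\<bar> \<le> sqrt (2 * r) / 2}"
        using le unfolding mem_Collect_eq abs_le_iff of_int_le_iff[symmetric, where 'a = real]
        by (simp add: field_simps)
    qed
    then have "card Y \<le> card {t::int. \<bar>of_int t - (of_int t0 + sqrt (2 * r) / 2)\<bar> \<le> sqrt (2 * r) / 2}"
      using assms by (intro card_mono card_int_close_le(1)) auto
    then show ?thesis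
      using card_int_close_le(2)[of "sqrt (2 * r) / 2" "of_int t0 + sqrt (2 * r) / 2"] assms by simp
  qed (use assms in simp)
  have "X \<subseteq> Y \<union> uminus ` Y"
  proof
    fix t assume "t \<in> X"
    then have "\<bar>t\<bar> \<in> Y" by (auto simp: X_def Y_def)
    then show "t \<in> Y \<union> uminus ` Y" by (cases "0 \<le> t") (auto simp: image_iff intro: bexI[of _ "- t"])
  qed
  then have "card X \<le> card (Y \<union> uminus ` Y)"
    using finY by (intro card_mono) auto
  also have "\<dots> \<le> card Y + card (uminus ` Y)" by (rule card_Un_le)
  also have "card (uminus ` Y) \<le> card Y" by (rule card_image_le[OF finY])
  finally show "real (card {t::int. \<bar>(of_int t)\<^sup>2 - a\<bar> \<le> r}) \<le> 2 * sqrt (2 * r) + 2"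
    using cardY by (simp add: X_def)
qed

text \<open>Twice \<open>k\<^sub>1\<^sup>2 + (k - k\<^sub>1)\<^sup>2\<close> equals \<open>(2 k\<^sub>1 - k)\<^sup>2 + k\<^sup>2\<close>.  For each lattice point \<open>z\<close> this turns the condition on
\<open>k\<^sub>1\<close> into one on the square of the integer \<open>2 k\<^sub>1 - k\<close>, which leaves \<open>O(2\<^bsup>j/2\<^esup>)\<close> choices.  Since
\<open>k\<^sub>1\<^sup>2 + (k - k\<^sub>1)\<^sup>2\<close> ranges over \<open>[0, 8 K\<^sup>2]\<close>, only \<open>O(K\<^sup>2 \<tau> + 2\<^sup>j \<tau> + 1) = O(K\<^sup>2 \<tau>)\<close>
lattice points can occur.\<close>

lemma card_resonant_frequencies_le:
  fixes \<tau> K c :: real and k :: int and j :: nat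
  assumes tau: "0 < \<tau>" and K: "1 \<le> K\<^sup>2 * \<tau>" and j: "2 ^ j * \<tau> \<le> 3"
  defines "X \<equiv> {k1::int. \<bar>of_int k1\<bar> \<le> 2 * K \<and> \<bar>of_int (k - k1)\<bar> \<le> 2 * K \<and>
    (\<exists>z::int. \<bar>c - (of_int k1)\<^sup>2 - (of_int (k - k1))\<^sup>2 - 2 * pi * of_int z / \<tau>\<bar> \<le> 2 * pi * 2 ^ j)}"
  shows "finite X" "real (card X) \<le> 117 * \<tau> * K\<^sup>2 * 2 powr (real j / 2)"
proof -
  define \<rho> where "\<rho> = 2 * pi * 2 ^ j"
  have rho: "0 \<le> \<rho>" by (simp add: \<rho>_def)
  define Z where "Z = {z::int. \<bar>of_int z - \<tau> / (2 * pi) * (c - 4 * K\<^sup>2)\<bar> \<le> \<tau> / (2 * pi) * (4 * K\<^sup>2 + \<rho>)}"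
  have finZ: "finite Z" unfolding Z_def using tau rho by (intro card_int_close_le) auto
  define f where "f z = {k1::int. \<bar>(of_int (2 * k1 - k))\<^sup>2 - (2 * (c - 2 * pi * of_int z / \<tau>) - (of_int k)\<^sup>2)\<bar> \<le> 2 * \<rho>}" for z :: int
  have f: "finite (f z) \<and> real (card (f z)) \<le> 13 * 2 powr (real j / 2)" for z
  proof -
    define a where "a = 2 * (c - 2 * pi * of_int z / \<tau>) - (of_int k)\<^sup>2"
    have im: "(\<lambda>k1. 2 * k1 - k) ` f z \<subseteq> {t::int. \<bar>(of_int t)\<^sup>2 - a\<bar> \<le> 2 * \<rho>}"
      by (auto simp: f_def a_def)
    have inj: "inj_on (\<lambda>k1::int. 2 * k1 - k) (f z)" by (auto simp: inj_on_def)
    have fin: "finite (f z)"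
      using finite_imageD[OF finite_subset[OF im card_int_square_close_le(1)] inj] rho by simp
    have "real (card (f z)) \<le> 2 * sqrt (2 * (2 * \<rho>)) + 2"
      using card_int_square_close_le(2)[of "2 * \<rho>" a] card_mono[OF card_int_square_close_le(1) im]
        card_image[OF inj] rho by simp
    also have "sqrt (2 * (2 * \<rho>)) \<le> 2 * (2.6 * 2 powr (real j / 2))"
    proof (rule real_le_lsqrt)
      have "(2 powr (real j / 2))\<^sup>2 = (2::real) ^ j"
        by (simp add: power2_eq_square powr_add[symmetric] powr_realpow)
      moreover have "2 * pi \<le> 2.6\<^sup>2" using pi_less_4 pi_approx by (simp add: power2_eq_square)
      then have "4 * 2 ^ j * (2 * pi) \<le> 4 * 2 ^ j * 2.6\<^sup>2"
        by (intro mult_left_mono) auto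
      ultimately show "2 * (2 * \<rho>) \<le> (2 * (2.6 * 2 powr (real j / 2)))\<^sup>2"
        unfolding \<rho>_def power_mult_distrib by (simp add: mult_ac)
    qed auto
    also have "2 * (2 * (2.6 * 2 powr (real j / 2))) + 2 \<le> 13 * 2 powr (real j / 2)"
      using ge_one_powr_ge_zero[of 2 "real j / 2"] by simp
    finally show ?thesis using fin by simp
  qed
  have sub: "X \<subseteq> (\<Union>z\<in>Z. f z)"
  proof
    fix k1 assume "k1 \<in> X"
    then obtain z :: int where k: "\<bar>of_int k1\<bar> \<le> 2 * K" "\<bar>of_int (k - k1)\<bar> \<le> 2 * K"
      and z: "\<bar>c - (of_int k1)\<^sup>2 - (of_int (k - k1))\<^sup>2 - 2 * pi * of_int z / \<tau>\<bar> \<le> \<rho>"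
      by (auto simp: X_def \<rho>_def)
    have sq: "(of_int k1)\<^sup>2 \<le> 4 * K\<^sup>2" "(of_int (k - k1))\<^sup>2 \<le> 4 * K\<^sup>2"
      using power_mono[OF k(1), of 2] power_mono[OF k(2), of 2] by (auto simp: power_mult_distrib)
    have "\<bar>2 * pi * of_int z / \<tau> - (c - 4 * K\<^sup>2)\<bar> \<le> 4 * K\<^sup>2 + \<rho>"
      using z sq zero_le_power2[of "real_of_int k1"] zero_le_power2[of "real_of_int (k - k1)"]
      unfolding abs_le_iff by linarith
    then have "\<tau> / (2 * pi) * \<bar>2 * pi * of_int z / \<tau> - (c - 4 * K\<^sup>2)\<bar> \<le> \<tau> / (2 * pi) * (4 * K\<^sup>2 + \<rho>)"
      using tau by (intro mult_left_mono) auto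
    moreover have "\<tau> / (2 * pi) * \<bar>2 * pi * of_int z / \<tau> - (c - 4 * K\<^sup>2)\<bar>
      = \<bar>\<tau> / (2 * pi) * (2 * pi * of_int z / \<tau> - (c - 4 * K\<^sup>2))\<bar>"
      using tau by (simp add: abs_mult)
    moreover have "\<tau> / (2 * pi) * (2 * pi * of_int z / \<tau> - (c - 4 * K\<^sup>2))
       = of_int z - \<tau> / (2 * pi) * (c - 4 * K\<^sup>2)"
      using tau by (simp add: right_diff_distrib)
    ultimately have "z \<in> Z" unfolding Z_def by (metis (lifting) mem_Collect_eq)
    moreover have "k1 \<in> f z"
    proof -
      have "(of_int (2 * k1 - k))\<^sup>2 - (2 * (c - 2 * pi * of_int z / \<tau>) - (of_int k)\<^sup>2)
        = - 2 * (c - (of_int k1)\<^sup>2 - (of_int (k - k1))\<^sup>2 - 2 * pi * of_int z / \<tau>)"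
        by (simp add: power2_eq_square algebra_simps)
      then show ?thesis using z by (simp add: f_def abs_mult)
    qed
    ultimately show "k1 \<in> (\<Union>z\<in>Z. f z)" by blast
  qed
  show "finite X" using finite_subset[OF sub] finZ f by blast
  have "real (card X) \<le> real (card (\<Union>z\<in>Z. f z))"
    using sub finZ f by (intro of_nat_mono card_mono) auto
  also have "\<dots> \<le> real (\<Sum>z\<in>Z. card (f z))"
    by (intro of_nat_mono card_UN_le finZ)
  also have "\<dots> \<le> (\<Sum>z\<in>Z. 13 * 2 powr (real j / 2))"
    unfolding of_nat_sum using f by (intro sum_mono) auto
  also have "\<dots> = real (card Z) * (13 * 2 powr (real j / 2))" by simp
  also have "\<dots> \<le> (9 * \<tau> * K\<^sup>2) * (13 * 2 powr (real j / 2))"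
  proof (rule mult_right_mono)
    have "real (card Z) \<le> 2 * (\<tau> / (2 * pi) * (4 * K\<^sup>2 + \<rho>)) + 1"
      unfolding Z_def using tau rho by (intro card_int_close_le) auto
    also have "\<dots> = 4 / pi * (\<tau> * K\<^sup>2) + 2 * (2 ^ j * \<tau>) + 1"
      by (simp add: \<rho>_def field_simps)
    also have "\<dots> \<le> 2 * (\<tau> * K\<^sup>2) + 2 * 3 + 1"
      using j tau pi_gt3 by (intro add_mono mult_right_mono mult_left_mono) (auto simp: field_simps)
    also have "\<dots> \<le> 9 * (\<tau> * K\<^sup>2)" using K by (simp add: mult.commute)
    finally show "real (card Z) \<le> 9 * \<tau> * K\<^sup>2" by simp
  qed auto
  finally show "real (card X) \<le> 117 * \<tau> * K\<^sup>2 * 2 powr (real j / 2)" by simp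
qed

text \<open>The points \<open>grid_point \<tau> P \<beta> l\<close> with \<open>0 \<le> l < P\<close> divide a period of length \<open>2 \<pi> / \<tau>\<close> into \<open>P\<close> equal
parts; the offset \<open>\<beta>\<close> is free and is chosen later by averaging.\<close>

definition grid_point :: "real \<Rightarrow> int \<Rightarrow> real \<Rightarrow> int \<Rightarrow> real" where
  "grid_point \<tau> P \<beta> l = \<beta> + of_int l * (2 * pi / (\<tau> * of_int P))"

lemma card_grid_near_period_le:
  fixes \<tau> c \<beta> :: real and P :: int and i :: nat
  assumes tau: "0 < \<tau>" and P: "1 \<le> \<tau> * of_int P"
  defines "Y \<equiv> {l \<in> {0..<P}. \<exists>z::int. \<bar>grid_point \<tau> P \<beta> l - c - 2 * pi * of_int z / \<tau>\<bar> \<le> pi * 2 ^ i}"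
  shows "real (card Y) \<le> 2 * (\<tau> * of_int P) * 2 ^ i"
proof -
  have P0: "0 < P" using tau P by (smt (verit) of_int_le_0_iff zero_less_mult_pos)
  define h where "h = 2 * pi / (\<tau> * of_int P)"
  have h: "0 < h" using tau P0 by (simp add: h_def)
  define T where "T = {t::int. \<bar>of_int t - (c - \<beta>) / h\<bar> \<le> pi * 2 ^ i / h}"
  have finT: "finite T" unfolding T_def using h by (intro card_int_close_le) auto
  have "Y \<subseteq> (\<lambda>t. t mod P) ` T"
  proof
    fix l assume "l \<in> Y"
    then obtain z :: int where l: "0 \<le> l" "l < P"
      and z: "\<bar>grid_point \<tau> P \<beta> l - c - 2 * pi * of_int z / \<tau>\<bar> \<le> pi * 2 ^ i"
      by (auto simp: Y_def)
    have "grid_point \<tau> P \<beta> l - c - 2 * pi * of_int z / \<tau> = (of_int (l - z * P) - (c - \<beta>) / h) * h"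
    proof -
      have e: "2 * pi * of_int z / \<tau> = of_int (z * P) * h" using tau P0 by (simp add: h_def)
      have g: "grid_point \<tau> P \<beta> l = \<beta> + of_int l * h" by (simp add: grid_point_def h_def)
      have "(c - \<beta>) / h * h = c - \<beta>" using h by simp
      then show ?thesis unfolding e g left_diff_distrib by (simp add: algebra_simps)
    qed
    with z h have "\<bar>of_int (l - z * P) - (c - \<beta>) / h\<bar> \<le> pi * 2 ^ i / h"
      by (simp add: abs_mult pos_le_divide_eq)
    then have "l - z * P \<in> T" by (simp add: T_def)
    moreover have "l = (l - z * P) mod P" using l by (simp add: mod_diff_right_eq[symmetric])
    ultimately show "l \<in> (\<lambda>t. t mod P) ` T" by blast
  qed
  then have "card Y \<le> card T"
    using finT by (rule surj_card_le[rotated])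
  also have "real (card T) \<le> 2 * (pi * 2 ^ i / h) + 1"
    unfolding T_def using h by (intro card_int_close_le) auto
  also have "2 * (pi * 2 ^ i / h) = (\<tau> * of_int P) * 2 ^ i"
    using tau P0 by (simp add: h_def)
  also have "(\<tau> * of_int P) * 2 ^ i + 1 \<le> (\<tau> * of_int P) * 2 ^ i + (\<tau> * of_int P) * 2 ^ i"
    using mult_mono[OF P one_le_power[of 2 i]] P by simp
  finally show ?thesis by simp
qed

text \<open>The frequencies that survive the filter \<open>\<Pi>\<^sub>K\<close>: the cutoff is supported in \<open>[-2, 2]\<close>.\<close>

definition freqs :: "real \<Rightarrow> int set" where
  "freqs K = {k. \<bar>of_int k\<bar> \<le> 2 * K}"

lemma finite_freqs [simp]: "finite (freqs K)"
proof (cases "0 \<le> K")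
  case True
  then show ?thesis using card_int_close_le(1)[of "2 * K" 0] by (simp add: freqs_def)
next
  case False
  then have "freqs K = {}" by (auto simp: freqs_def)
  then show ?thesis by simp
qed

text \<open>A pair in the fibre is determined by its first entry \<open>(l\<^sub>1, k\<^sub>1)\<close>.  Adding the two nearness conditions eliminates
\<open>l\<^sub>1\<close>, because \<open>l\<^sub>1 + l\<^sub>2\<close> is \<open>l\<close> up to multiples of \<open>P\<close>, that is, up to periods.  What remains is the condition on
\<open>k\<^sub>1\<close> alone that \<open>card_resonant_frequencies_le\<close> counts; then \<open>l\<^sub>1\<close> is counted for fixed \<open>k\<^sub>1\<close> by the
sharper condition, the one with index \<open>i\<close>.\<close>

lemma card_convolution_fibre_le:
  fixes \<tau> K \<beta> :: real and P l k :: int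
  assumes tau: "0 < \<tau>" and K: "1 \<le> K\<^sup>2 * \<tau>" and P: "1 \<le> \<tau> * of_int P"
    and ij: "i \<le> j" and j: "2 ^ j * \<tau> \<le> 3"
  defines "near \<equiv> (\<lambda>i (p::int\<times>int). \<exists>z::int.
     \<bar>grid_point \<tau> P \<beta> (fst p) - (of_int (snd p))\<^sup>2 - 2 * pi * of_int z / \<tau>\<bar> \<le> pi * 2 ^ i)"
  shows "real (card {(x, y). x \<in> {0..<P} \<times> freqs K \<and> y \<in> {0..<P} \<times> freqs K \<and>
      near i x \<and> near j y \<and> ((fst x + fst y) mod P, snd x + snd y) = (l, k)})
    \<le> 234 * (\<tau> * of_int P) * \<tau> * K\<^sup>2 * (2 ^ i * 2 powr (real j / 2))"
proof -
  have P0: "0 < P" using tau P by (smt (verit) of_int_le_0_iff zero_less_mult_pos)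
  define U where "U = {(x, y). x \<in> {0..<P} \<times> freqs K \<and> y \<in> {0..<P} \<times> freqs K \<and>
      near i x \<and> near j y \<and> ((fst x + fst y) mod P, snd x + snd y) = (l, k)}"
  define c where "c = 2 * \<beta> + of_int l * (2 * pi / (\<tau> * of_int P))"
  define X where "X = {k1::int. \<bar>of_int k1\<bar> \<le> 2 * K \<and> \<bar>of_int (k - k1)\<bar> \<le> 2 * K \<and>
    (\<exists>z::int. \<bar>c - (of_int k1)\<^sup>2 - (of_int (k - k1))\<^sup>2 - 2 * pi * of_int z / \<tau>\<bar> \<le> 2 * pi * 2 ^ j)}"
  define Y where "Y k1 = {l1 \<in> {0..<P}. \<exists>z::int. \<bar>grid_point \<tau> P \<beta> l1 - (of_int k1)\<^sup>2 - 2 * pi * of_int z / \<tau>\<bar> \<le> pi * 2 ^ i}" for k1 :: int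
  note X = card_resonant_frequencies_le[OF tau K j, of k c, folded X_def]
  have Y: "real (card (Y k1)) \<le> 2 * (\<tau> * of_int P) * 2 ^ i" for k1
    unfolding Y_def by (rule card_grid_near_period_le[OF tau P])
  have finY: "finite (Y k1)" for k1 by (rule finite_subset[of _ "{0..<P}"]) (auto simp: Y_def)
  have inj: "inj_on (\<lambda>(x, y). (snd x, fst x)) U"
  proof (rule inj_onI)
    fix p q assume p: "p \<in> U" and q: "q \<in> U"
      and e: "(\<lambda>(x, y). (snd x, fst x)) p = (\<lambda>(x, y). (snd x, fst x)) q"
    obtain l1 k1 l2 k2 l3 k3 l4 k4 where [simp]: "p = ((l1, k1), (l2, k2))" "q = ((l3, k3), (l4, k4))"
      by (metis surj_pair)
    have [simp]: "l3 = l1" "k3 = k1" using e by auto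
    have "(l1 + l2) mod P = (l1 + l4) mod P" "k2 = k4" using p q by (auto simp: U_def)
    then have "l2 mod P = l4 mod P" by (metis add_diff_cancel_left' mod_diff_left_eq)
    moreover have "0 \<le> l2" "l2 < P" "0 \<le> l4" "l4 < P" using p q by (auto simp: U_def)
    ultimately show "p = q" using \<open>k2 = k4\<close> by simp
  qed
  have sub: "(\<lambda>(x, y). (snd x, fst x)) ` U \<subseteq> (SIGMA k1:X. Y k1)"
  proof clarsimp
    fix l1 k1 l2 k2 assume u: "((l1, k1), (l2, k2)) \<in> U"
    then obtain z1 z2 :: int where
      z1: "\<bar>grid_point \<tau> P \<beta> l1 - (of_int k1)\<^sup>2 - 2 * pi * of_int z1 / \<tau>\<bar> \<le> pi * 2 ^ i" and
      z2: "\<bar>grid_point \<tau> P \<beta> l2 - (of_int k2)\<^sup>2 - 2 * pi * of_int z2 / \<tau>\<bar> \<le> pi * 2 ^ j"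
      by (auto simp: U_def near_def)
    have l: "(l1 + l2) mod P = l" and k2: "k2 = k - k1" using u by (auto simp: U_def)
    define q where "q = (l1 + l2) div P"
    have ll: "l1 + l2 = q * P + l" using l by (metis q_def div_mult_mod_eq)
    have "grid_point \<tau> P \<beta> l1 + grid_point \<tau> P \<beta> l2
        = 2 * \<beta> + of_int (l1 + l2) * (2 * pi / (\<tau> * of_int P))"
      by (simp add: grid_point_def algebra_simps add_divide_distrib)
    also have "\<dots> = c + 2 * pi * of_int q / \<tau>"
      unfolding ll c_def using P0 tau by (simp add: field_simps)
    finally have g: "grid_point \<tau> P \<beta> l1 + grid_point \<tau> P \<beta> l2 = c + 2 * pi * of_int q / \<tau>" .
    have zz: "2 * pi * of_int (z1 + z2 - q) / \<tau> = 2 * pi * of_int z1 / \<tau> + 2 * pi * of_int z2 / \<tau> - 2 * pi * of_int q / \<tau>"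
      by (simp only: of_int_add of_int_diff distrib_left right_diff_distrib add_divide_distrib diff_divide_distrib)
    have "pi * 2 ^ i \<le> pi * 2 ^ j" using ij by simp
    then have "\<bar>c - (of_int k1)\<^sup>2 - (of_int k2)\<^sup>2 - 2 * pi * of_int (z1 + z2 - q) / \<tau>\<bar> \<le> 2 * pi * 2 ^ j"
      using z1 z2 g zz unfolding abs_le_iff by linarith
    then have "\<exists>z::int. \<bar>c - (of_int k1)\<^sup>2 - (of_int (k - k1))\<^sup>2 - 2 * pi * of_int z / \<tau>\<bar> \<le> 2 * pi * 2 ^ j"
      unfolding k2 by blast
    moreover have "\<bar>of_int k1\<bar> \<le> 2 * K" "\<bar>of_int (k - k1)\<bar> \<le> 2 * K"
      using u k2 by (auto simp: U_def freqs_def)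
    ultimately have "k1 \<in> X" unfolding X_def by blast
    moreover have "l1 \<in> Y k1" using u z1 by (auto simp: U_def Y_def)
    ultimately show "k1 \<in> X \<and> l1 \<in> Y k1" ..
  qed
  have "real (card U) = real (card ((\<lambda>(x, y). (snd x, fst x)) ` U))"
    by (simp add: card_image[OF inj])
  also have "\<dots> \<le> real (card (SIGMA k1:X. Y k1))"
    using X(1) finY sub by (intro of_nat_mono card_mono) auto
  also have "\<dots> = (\<Sum>k1\<in>X. real (card (Y k1)))"
    using X(1) finY by simp
  also have "\<dots> \<le> (\<Sum>k1\<in>X. 2 * (\<tau> * of_int P) * 2 ^ i)"
    by (intro sum_mono Y)
  also have "\<dots> = real (card X) * (2 * (\<tau> * of_int P) * 2 ^ i)" by simp
  also have "\<dots> \<le> (117 * \<tau> * K\<^sup>2 * 2 powr (real j / 2)) * (2 * (\<tau> * of_int P) * 2 ^ i)"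
    using X(2) tau P by (intro mult_right_mono) auto
  finally show ?thesis by (simp add: U_def mult_ac)
qed

section \<open>Plancherel on a finite grid of time frequencies and on the torus\<close>

lemma norm_sum_squared_expand:
  fixes z :: "'i \<Rightarrow> complex"
  shows "of_real ((norm (\<Sum>i\<in>I. z i))\<^sup>2) = (\<Sum>i\<in>I. \<Sum>j\<in>I. z i * cnj (z j))"
  by (simp only: complex_norm_square cnj_sum sum_product)

lemma mult_cis_cnj: "u * cis a * cnj (v * cis b) = u * cnj v * cis (a - b)"
  unfolding complex_cnj_mult cis_cnj diff_conv_add_uminus cis_mult[symmetric] by (simp only: mult_ac)

lemma has_integral_cis_int:
  fixes k :: int
  shows "((\<lambda>x. cis (of_int k * x)) has_integral (if k = 0 then of_real (2 * pi) else 0)) {-pi..pi}"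
proof (cases "k = 0")
  case True
  then show ?thesis using has_integral_const_real[of "1::complex" "-pi" pi]
    by (simp add: scaleR_conv_of_real)
next
  case False
  have "((\<lambda>x. cis (of_int k * x)) has_integral
      (cis (of_int k * pi) / (\<i> * of_int k) - cis (of_int k * (- pi)) / (\<i> * of_int k))) {-pi..pi}"
  proof (rule fundamental_theorem_of_calculus)
    show "((\<lambda>x. cis (of_int k * x) / (\<i> * of_int k)) has_vector_derivative cis (of_int k * x)) (at x within {-pi..pi})"
      for x :: real
      unfolding cis_conv_exp using False
      by (auto intro!: derivative_eq_intros has_vector_derivative_real_field simp: field_simps)
  qed simp
  moreover have "cis (of_int k * pi) = cis (of_int k * (- pi))"
  proof -
    have "cis (of_int k * pi) = cis (of_int k * (- pi)) * cis (2 * pi * of_int k)"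
      by (simp only: cis_mult) (simp add: algebra_simps)
    then show ?thesis by simp
  qed
  ultimately show ?thesis using False by simp
qed

lemma has_integral_norm_sum_cis:
  fixes c :: "int \<Rightarrow> complex"
  assumes "finite J"
  shows "((\<lambda>x. (norm (\<Sum>k\<in>J. c k * cis (of_int k * x)))\<^sup>2) has_integral (2 * pi * (\<Sum>k\<in>J. (norm (c k))\<^sup>2))) {-pi..pi}"
proof -
  have "((\<lambda>x. \<Sum>k\<in>J. \<Sum>k'\<in>J. c k * cnj (c k') * cis (of_int (k - k') * x)) has_integral
     (\<Sum>k\<in>J. \<Sum>k'\<in>J. c k * cnj (c k') * (if k - k' = 0 then of_real (2 * pi) else 0))) {-pi..pi}"
    by (intro has_integral_sum assms has_integral_mult_right has_integral_cis_int)
  moreover have "(\<Sum>k\<in>J. \<Sum>k'\<in>J. c k * cnj (c k') * cis (of_int (k - k') * x))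
      = of_real ((norm (\<Sum>k\<in>J. c k * cis (of_int k * x)))\<^sup>2)" for x
    unfolding norm_sum_squared_expand
    by (simp only: mult_cis_cnj left_diff_distrib of_int_diff)
  moreover have "(\<Sum>k\<in>J. \<Sum>k'\<in>J. c k * cnj (c k') * (if k - k' = 0 then of_real (2 * pi) else 0))
      = of_real (2 * pi * (\<Sum>k\<in>J. (norm (c k))\<^sup>2))"
  proof -
    have "(\<Sum>k'\<in>J. c k * cnj (c k') * (if k - k' = 0 then of_real (2 * pi) else 0))
       = of_real (2 * pi) * of_real ((norm (c k))\<^sup>2)" if "k \<in> J" for k
    proof -
      have "(\<Sum>k'\<in>J. c k * cnj (c k') * (if k - k' = 0 then of_real (2 * pi) else 0))
        = (\<Sum>k'\<in>J. if k' = k then c k * cnj (c k) * of_real (2 * pi) else 0)"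
        by (intro sum.cong) auto
      also have "\<dots> = c k * cnj (c k) * of_real (2 * pi)" using that assms by simp
      finally show ?thesis by (simp only: complex_norm_square mult.commute)
    qed
    then show ?thesis by (simp add: sum_distrib_left)
  qed
  ultimately have "((\<lambda>x. complex_of_real ((norm (\<Sum>k\<in>J. c k * cis (of_int k * x)))\<^sup>2)) has_integral
     of_real (2 * pi * (\<Sum>k\<in>J. (norm (c k))\<^sup>2))) {-pi..pi}"
    by (simp only:)
  from has_integral_linear[OF this bounded_linear_Re] show ?thesis
    by (simp only: o_def Re_complex_of_real)
qed

lemma sum_int_interval_shift:
  fixes f :: "int \<Rightarrow> 'a::comm_monoid_add"
  assumes "0 \<le> P"
  shows "(\<Sum>n\<in>{a..<a+P}. f n) = (\<Sum>m<nat P. f (a + int m))"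
proof -
  have "{a..<a+P} = (\<lambda>m. a + int m) ` {..<nat P}"
  proof (intro equalityI subsetI)
    fix n assume "n \<in> {a..<a+P}"
    then have "n = a + int (nat (n - a))" "nat (n - a) < nat P" by auto
    then show "n \<in> (\<lambda>m. a + int m) ` {..<nat P}" by blast
  qed (use assms in auto)
  then show ?thesis by (simp add: sum.reindex inj_on_def)
qed

lemma sum_cis_residues:
  fixes P d a :: int
  assumes P: "0 < P"
  shows "(\<Sum>n\<in>{a..<a+P}. cis (2 * pi * of_int (n * d) / of_int P)) = (if P dvd d then of_int P else 0)"
proof -
  define z where "z = cis (2 * pi * of_int d / of_int P)"
  have "(\<Sum>n\<in>{a..<a+P}. cis (2 * pi * of_int (n * d) / of_int P))
      = (\<Sum>m<nat P. cis (2 * pi * of_int (a * d) / of_int P) * z ^ m)"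
    using P by (subst sum_int_interval_shift)
      (auto intro!: sum.cong simp: z_def Complex.DeMoivre cis_mult field_simps)
  also have "\<dots> = cis (2 * pi * of_int (a * d) / of_int P) * (\<Sum>m<nat P. z ^ m)"
    by (simp add: sum_distrib_left)
  finally have eq: "(\<Sum>n\<in>{a..<a+P}. cis (2 * pi * of_int (n * d) / of_int P))
    = cis (2 * pi * of_int (a * d) / of_int P) * (\<Sum>m<nat P. z ^ m)" .
  show ?thesis
  proof (cases "P dvd d")
    case True
    then obtain e where e: "d = P * e" by blast
    have "2 * pi * of_int d / of_int P = 2 * pi * of_int e" using P by (simp add: e)
    then have z: "z = 1" unfolding z_def by (simp only:) (rule cis_multiple_2pi, simp)
    have "2 * pi * of_int (a * d) / of_int P = 2 * pi * of_int (a * e)" using P by (simp add: e)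
    then have "cis (2 * pi * of_int (a * d) / of_int P) = 1" by (simp only:) (rule cis_multiple_2pi, simp)
    then show ?thesis using eq z True P by simp
  next
    case False
    have "z \<noteq> 1"
    proof
      assume "z = 1"
      then have "cos (2 * pi * of_int d / of_int P) = 1" by (simp add: z_def complex_eq_iff)
      then obtain n :: int where "2 * pi * of_int d / of_int P = of_int n * 2 * pi"
        using cos_one_2pi_int by blast
      then have "real_of_int d = of_int (n * P)" using P by (simp add: field_simps)
      then have "d = n * P" by (simp only: of_int_eq_iff)
      with False show False by simp
    qed
    moreover have "z ^ nat P = 1"
    proof -
      have "z ^ nat P = cis (2 * pi * of_int d)" using P by (simp add: z_def Complex.DeMoivre)
      then show ?thesis by simp
    qed
    ultimately have "(\<Sum>m<nat P. z ^ m) = 0" by (simp add: sum_gp_strict)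
    then show ?thesis using eq False by simp
  qed
qed

text \<open>Plancherel for the discrete Fourier transform modulo \<open>P\<close>.  The starting point \<open>a\<close> is free because the times of
interest are symmetric about the origin.\<close>

lemma sum_norm_sum_cis_residues:
  fixes c :: "int \<Rightarrow> complex" and P a :: int
  assumes P: "0 < P"
  shows "(\<Sum>n\<in>{a..<a+P}. (norm (\<Sum>l\<in>{0..<P}. c l * cis (- (2 * pi * of_int (n * l) / of_int P))))\<^sup>2)
      = of_int P * (\<Sum>l\<in>{0..<P}. (norm (c l))\<^sup>2)"
proof -
  define L where "L = {0..<P}"
  have "complex_of_real (\<Sum>n\<in>{a..<a+P}. (norm (\<Sum>l\<in>L. c l * cis (- (2 * pi * of_int (n * l) / of_int P))))\<^sup>2)
    = (\<Sum>n\<in>{a..<a+P}. \<Sum>l\<in>L. \<Sum>l'\<in>L. c l * cnj (c l') * cis (2 * pi * of_int (n * (l' - l)) / of_int P))"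
    unfolding of_real_sum norm_sum_squared_expand
  proof (intro sum.cong refl)
    fix n l l' :: int
    have "- (2 * pi * of_int (n * l) / of_int P) - - (2 * pi * of_int (n * l') / of_int P)
      = 2 * pi * of_int (n * (l' - l)) / of_int P"
      by (simp add: right_diff_distrib diff_divide_distrib)
    then show "c l * cis (- (2 * pi * of_int (n * l) / of_int P)) * cnj (c l' * cis (- (2 * pi * of_int (n * l') / of_int P)))
      = c l * cnj (c l') * cis (2 * pi * of_int (n * (l' - l)) / of_int P)"
      by (simp only: mult_cis_cnj)
  qed
  also have "\<dots> = (\<Sum>l\<in>L. \<Sum>l'\<in>L. c l * cnj (c l') * (\<Sum>n\<in>{a..<a+P}. cis (2 * pi * of_int (n * (l' - l)) / of_int P)))"
    unfolding sum_distrib_left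
    by (subst sum.swap) (intro sum.cong refl sum.swap)
  also have "\<dots> = (\<Sum>l\<in>L. of_int P * of_real ((norm (c l))\<^sup>2))"
  proof (rule sum.cong[OF refl])
    fix l assume l: "l \<in> L"
    have "P dvd (l' - l) \<longleftrightarrow> l' = l" if "l' \<in> L" for l'
      using that l by (auto simp: L_def mod_eq_dvd_iff[symmetric])
    then have "(\<Sum>l'\<in>L. c l * cnj (c l') * (\<Sum>n\<in>{a..<a+P}. cis (2 * pi * of_int (n * (l' - l)) / of_int P)))
       = (\<Sum>l'\<in>L. if l' = l then c l * cnj (c l) * of_int P else 0)"
      unfolding sum_cis_residues[OF P] by (intro sum.cong refl) auto
    also have "\<dots> = c l * cnj (c l) * of_int P" using l by (simp add: L_def)
    finally show "(\<Sum>l'\<in>L. c l * cnj (c l') * (\<Sum>n\<in>{a..<a+P}. cis (2 * pi * of_int (n * (l' - l)) / of_int P)))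
       = of_int P * of_real ((norm (c l))\<^sup>2)" by (simp only: complex_norm_square mult.commute)
  qed
  also have "\<dots> = complex_of_real (of_int P * (\<Sum>l\<in>L. (norm (c l))\<^sup>2))"
    by (simp add: sum_distrib_left)
  finally show ?thesis unfolding L_def by (simp only: of_real_eq_iff)
qed

lemma sum_Times_swap:
  fixes f :: "'a \<times> 'b \<Rightarrow> 'c::comm_monoid_add"
  shows "(\<Sum>p\<in>A \<times> B. f p) = (\<Sum>k\<in>B. \<Sum>l\<in>A. f (l, k))"
  by (subst sum.swap) (simp add: sum.cartesian_product)

lemma plancherel_grid:
  fixes h :: "int \<times> int \<Rightarrow> complex" and P a :: int
  assumes P: "0 < P" and J: "finite J"
  shows "(\<Sum>n\<in>{a..<a+P}. integral {-pi..pi} (\<lambda>x. (norm (\<Sum>q\<in>{0..<P} \<times> J.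
       h q * cis (- (2 * pi * of_int (n * fst q) / of_int P)) * cis (of_int (snd q) * x)))\<^sup>2))
     = 2 * pi * of_int P * (\<Sum>q\<in>{0..<P} \<times> J. (norm (h q))\<^sup>2)"
proof -
  define c where "c n k = (\<Sum>l\<in>{0..<P}. h (l, k) * cis (- (2 * pi * of_int (n * l) / of_int P)))" for n k
  have "(\<Sum>q\<in>{0..<P} \<times> J. h q * cis (- (2 * pi * of_int (n * fst q) / of_int P)) * cis (of_int (snd q) * x))
      = (\<Sum>k\<in>J. c n k * cis (of_int k * x))" for n x
    by (simp add: c_def sum_distrib_right sum_Times_swap)
  then have "(\<Sum>n\<in>{a..<a+P}. integral {-pi..pi} (\<lambda>x. (norm (\<Sum>q\<in>{0..<P} \<times> J.
       h q * cis (- (2 * pi * of_int (n * fst q) / of_int P)) * cis (of_int (snd q) * x)))\<^sup>2))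
     = (\<Sum>n\<in>{a..<a+P}. 2 * pi * (\<Sum>k\<in>J. (norm (c n k))\<^sup>2))"
    by (simp add: integral_unique[OF has_integral_norm_sum_cis[OF J]])
  also have "\<dots> = 2 * pi * (\<Sum>k\<in>J. \<Sum>n\<in>{a..<a+P}. (norm (c n k))\<^sup>2)"
    unfolding sum_distrib_left by (rule sum.swap)
  also have "\<dots> = 2 * pi * (\<Sum>k\<in>J. of_int P * (\<Sum>l\<in>{0..<P}. (norm (h (l, k)))\<^sup>2))"
    unfolding c_def by (simp only: sum_norm_sum_cis_residues[OF P])
  also have "\<dots> = 2 * pi * of_int P * (\<Sum>q\<in>{0..<P} \<times> J. (norm (h q))\<^sup>2)"
    by (simp add: sum_Times_swap sum_distrib_left mult_ac)
  finally show ?thesis .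
qed

section \<open>The estimate on a grid\<close>

lemma one_le_japanese: "1 \<le> japanese a"
  unfolding japanese_def by (rule ge_one_powr_ge_zero) auto

lemma norm_le_japanese: "norm a \<le> japanese a"
proof -
  have "norm a = sqrt ((norm a)\<^sup>2)" by simp
  also have "\<dots> \<le> sqrt (1 + (norm a)\<^sup>2)" by (intro real_sqrt_le_mono) simp
  finally show ?thesis by (simp add: japanese_def powr_half_sqrt add_nonneg_nonneg)
qed

lemma japanese_d_sym_le:
  assumes "0 < \<tau>" "\<tau> \<le> 1"
  shows "japanese (d_sym \<tau> \<sigma>) \<le> 3 / \<tau>"
proof -
  have "norm (exp (\<i> * of_real \<tau> * of_real \<sigma>) - 1) \<le> norm (exp (\<i> * of_real \<tau> * of_real \<sigma>)) + norm (1::complex)"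
    by (rule norm_triangle_ineq4)
  also have "norm (exp (\<i> * of_real \<tau> * of_real \<sigma>)) = 1" by simp
  finally have "norm (d_sym \<tau> \<sigma>) \<le> 2 / \<tau>"
    using assms by (simp add: d_sym_def norm_divide divide_right_mono)
  then have "(norm (d_sym \<tau> \<sigma>))\<^sup>2 \<le> (2 / \<tau>)\<^sup>2" by (intro power_mono) auto
  moreover have "1 \<le> (1 / \<tau>)\<^sup>2" using assms by (simp add: power_le_one)
  ultimately have "1 + (norm (d_sym \<tau> \<sigma>))\<^sup>2 \<le> (3 / \<tau>)\<^sup>2"
    by (simp add: power_divide)
  then have "sqrt (1 + (norm (d_sym \<tau> \<sigma>))\<^sup>2) \<le> 3 / \<tau>"
    using assms by (intro real_le_lsqrt) auto
  then show ?thesis by (simp add: japanese_def powr_half_sqrt add_nonneg_nonneg)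
qed

definition dyadic_level :: "real \<Rightarrow> nat" where
  "dyadic_level w = nat \<lfloor>log 2 w\<rfloor>"

lemma dyadic_level_bounds:
  assumes "1 \<le> w"
  shows "2 ^ dyadic_level w \<le> w" "w < 2 * 2 ^ dyadic_level w"
proof -
  have l: "0 \<le> log 2 w" using assms by simp
  have "real (dyadic_level w) \<le> log 2 w" "log 2 w < real (dyadic_level w) + 1"
    using l by (auto simp: dyadic_level_def of_nat_nat)
  then have "2 powr real (dyadic_level w) \<le> w" "w < 2 powr (real (dyadic_level w) + 1)"
    using assms by (auto simp: le_log_iff log_less_iff)
  then show "2 ^ dyadic_level w \<le> w" "w < 2 * 2 ^ dyadic_level w"
    by (auto simp: powr_realpow powr_add)
qed

lemma level_imp_near_period:
  assumes tau: "0 < \<tau>" and lev: "dyadic_level (japanese (d_sym \<tau> \<sigma>)) = i"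
  shows "\<exists>z::int. \<bar>\<sigma> - 2 * pi * of_int z / \<tau>\<bar> \<le> pi * 2 ^ i"
proof -
  have "norm (d_sym \<tau> \<sigma>) \<le> 2 * 2 ^ i"
    using norm_le_japanese[of "d_sym \<tau> \<sigma>"] dyadic_level_bounds(2)[OF one_le_japanese, of "d_sym \<tau> \<sigma>"] lev
    by simp
  from d_sym_small_imp_near_period[OF tau this] show ?thesis by simp
qed

text \<open>The hypothesis of \<open>dyadic_bilinear\<close> for the grid.  Exchanging the two entries of a pair reduces to \<open>i \<le> j\<close>.  The
requirement \<open>2\<^sup>j \<tau> \<le> 3\<close> of the counting lemma is automatic when level \<open>j\<close> is occupied, since \<open>\<langle>d\<rangle> \<le> 3 / \<tau>\<close>.\<close>

lemma card_level_fibre_le: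
  fixes \<tau> K \<beta> :: real and P :: int
  assumes tau: "0 < \<tau>" "\<tau> \<le> 1" and K: "1 \<le> K\<^sup>2 * \<tau>" and P: "1 \<le> \<tau> * of_int P"
  defines "lev \<equiv> (\<lambda>p. dyadic_level (japanese (d_sym \<tau> (grid_point \<tau> P \<beta> (fst p) - (of_int (snd p))\<^sup>2))))"
  defines "S \<equiv> {0..<P} \<times> freqs K"
  shows "real (card {(x, y). x \<in> S \<and> y \<in> S \<and> lev x = i \<and> lev y = j \<and>
      ((fst x + fst y) mod P, snd x + snd y) = q})
    \<le> 234 * (\<tau> * of_int P) * \<tau> * K\<^sup>2 * 2 ^ min i j * 2 powr (real (max i j) / 2)"
proof -
  define T where "T i j = {(x, y). x \<in> S \<and> y \<in> S \<and> lev x = i \<and> lev y = j \<and>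
      ((fst x + fst y) mod P, snd x + snd y) = q}" for i j
  have R: "0 \<le> 234 * (\<tau> * of_int P) * \<tau> * K\<^sup>2" using tau P by simp
  have main: "real (card (T i j)) \<le> 234 * (\<tau> * of_int P) * \<tau> * K\<^sup>2 * (2 ^ i * 2 powr (real j / 2))"
    if ij: "i \<le> j" for i j
  proof (cases "T i j = {}")
    case True
    then show ?thesis using R by simp
  next
    case False
    then obtain y where "lev y = j" by (auto simp: T_def)
    then have "2 ^ j \<le> 3 / \<tau>"
      using dyadic_level_bounds(1)[OF one_le_japanese] japanese_d_sym_le[OF tau] order_trans
      unfolding lev_def by metis
    then have j: "2 ^ j * \<tau> \<le> 3" using tau by (simp add: field_simps)
    have "card (T i j) \<le> card {(x, y). x \<in> {0..<P} \<times> freqs K \<and> y \<in> {0..<P} \<times> freqs K \<and>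
      (\<exists>z::int. \<bar>grid_point \<tau> P \<beta> (fst x) - (of_int (snd x))\<^sup>2 - 2 * pi * of_int z / \<tau>\<bar> \<le> pi * 2 ^ i) \<and>
      (\<exists>z::int. \<bar>grid_point \<tau> P \<beta> (fst y) - (of_int (snd y))\<^sup>2 - 2 * pi * of_int z / \<tau>\<bar> \<le> pi * 2 ^ j) \<and>
      ((fst x + fst y) mod P, snd x + snd y) = (fst q, snd q)}"
    proof (rule card_mono)
      show "finite {(x, y). x \<in> {0..<P} \<times> freqs K \<and> y \<in> {0..<P} \<times> freqs K \<and>
      (\<exists>z::int. \<bar>grid_point \<tau> P \<beta> (fst x) - (of_int (snd x))\<^sup>2 - 2 * pi * of_int z / \<tau>\<bar> \<le> pi * 2 ^ i) \<and>
      (\<exists>z::int. \<bar>grid_point \<tau> P \<beta> (fst y) - (of_int (snd y))\<^sup>2 - 2 * pi * of_int z / \<tau>\<bar> \<le> pi * 2 ^ j) \<and>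
      ((fst x + fst y) mod P, snd x + snd y) = (fst q, snd q)}"
        by (rule finite_subset[of _ "({0..<P} \<times> freqs K) \<times> ({0..<P} \<times> freqs K)"]) auto
      show "T i j \<subseteq> {(x, y). x \<in> {0..<P} \<times> freqs K \<and> y \<in> {0..<P} \<times> freqs K \<and>
      (\<exists>z::int. \<bar>grid_point \<tau> P \<beta> (fst x) - (of_int (snd x))\<^sup>2 - 2 * pi * of_int z / \<tau>\<bar> \<le> pi * 2 ^ i) \<and>
      (\<exists>z::int. \<bar>grid_point \<tau> P \<beta> (fst y) - (of_int (snd y))\<^sup>2 - 2 * pi * of_int z / \<tau>\<bar> \<le> pi * 2 ^ j) \<and>
      ((fst x + fst y) mod P, snd x + snd y) = (fst q, snd q)}"
        unfolding T_def S_def lev_def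
        by (intro subsetI, unfold mem_Collect_eq case_prod_unfold prod.collapse)
          (blast intro: level_imp_near_period[OF tau(1)])
    qed
    then show ?thesis using card_convolution_fibre_le[OF tau(1) K P ij j, of \<beta> "fst q" "snd q"]
      by linarith
  qed
  have swap: "card (T i j) = card (T j i)" for i j
  proof (rule bij_betw_same_card)
    show "bij_betw prod.swap (T i j) (T j i)"
      by (rule bij_betwI[where g = prod.swap]) (auto simp: T_def add.commute)
  qed
  show ?thesis
    using main[of i j] main[of j i] swap[of i j]
    by (cases "i \<le> j") (auto simp: T_def[symmetric] min_def max_def mult.assoc)
qed

text \<open>The product of \<open>2 \<pi>\<close> from Plancherel on the torus, the factor \<open>234\<close> of the count, and the constant of the geometric
summation.\<close>

definition strichartz_const :: real where
  "strichartz_const = 468 * pi * (2 / (1 - 2 powr (- 1/8)))\<^sup>2"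

lemma strichartz_const_pos: "0 < strichartz_const"
proof -
  have "(2::real) powr (- 1/8) < 1" by (rule powr_less_one) auto
  then show ?thesis by (simp add: strichartz_const_def)
qed

text \<open>The square of the exponential sum is, up to a factor of modulus one that comes from the offset \<open>\<beta>\<close>, an exponential sum
over the frequencies \<open>add x y\<close>, whose coefficients \<open>h\<close> are the convolution square of \<open>A\<close>.  Plancherel then
turns the left-hand side into the \<open>\<ell>\<^sup>2\<close> norm of \<open>h\<close>, where signs are irrelevant and \<open>dyadic_bilinear\<close> applies.\<close>

lemma grid_strichartz:
  fixes \<tau> K \<beta> :: real and P a :: int and A :: "int \<Rightarrow> int \<Rightarrow> complex"
  assumes tau: "0 < \<tau>" "\<tau> \<le> 1" and K: "1 \<le> K\<^sup>2 * \<tau>" and P: "1 \<le> \<tau> * of_int P"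
  shows "(\<Sum>n\<in>{a..<a+P}. integral {-pi..pi} (\<lambda>x. norm (\<Sum>k\<in>freqs K. \<Sum>l\<in>{0..<P}.
        A l k * cis (- (of_int n * \<tau> * grid_point \<tau> P \<beta> l)) * cis (of_int k * x)) ^ 4))
    \<le> strichartz_const * (of_int P * \<tau> * K)\<^sup>2 *
      (\<Sum>k\<in>freqs K. \<Sum>l\<in>{0..<P}. japanese (d_sym \<tau> (grid_point \<tau> P \<beta> l - (of_int k)\<^sup>2)) powr (3/4)
         * (norm (A l k))\<^sup>2)\<^sup>2"
proof -
  have P0: "0 < P" using tau P by (smt (verit) of_int_le_0_iff zero_less_mult_pos)
  define S where "S = {0..<P} \<times> freqs K"
  define J where "J = freqs (2 * K)"
  define Q where "Q = {0..<P} \<times> J"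
  define add where "add x y = ((fst x + fst y) mod P, snd x + snd y)" for x y :: "int \<times> int"
  define lev where "lev p = dyadic_level (japanese (d_sym \<tau> (grid_point \<tau> P \<beta> (fst p) - (of_int (snd p))\<^sup>2)))" for p :: "int \<times> int"
  define B where "B p = A (fst p) (snd p)" for p
  define e where "e n x p = cis (- (of_int n * \<tau> * grid_point \<tau> P \<beta> (fst p))) * cis (of_int (snd p) * x)" for n :: int and x :: real and p :: "int \<times> int"
  define E where "E n x q = cis (- (2 * pi * of_int (n * fst q) / of_int P)) * cis (of_int (snd q) * x)" for n :: int and x :: real and q :: "int \<times> int"
  define h where "h q = (\<Sum>(x, y) | x \<in> S \<and> y \<in> S \<and> add x y = q. B x * B y)" for q
  have finS: "finite S" and finQ: "finite Q" and finJ: "finite J" by (auto simp: S_def Q_def J_def)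
  have addQ: "add x y \<in> Q" if "x \<in> S" "y \<in> S" for x y
    using that P0 by (auto simp: add_def S_def Q_def J_def freqs_def)
  \<comment> \<open>Reducing \<open>l\<^sub>1 + l\<^sub>2\<close> modulo \<open>P\<close> changes the phase by a multiple of \<open>2 \<pi>\<close>.\<close>
  have ee: "e n t x * e n t y = cis (- (of_int n * \<tau> * (2 * \<beta>))) * E n t (add x y)" for n t x y
  proof -
    define r where "r = (fst x + fst y) div P"
    have l: "fst x + fst y = r * P + (fst x + fst y) mod P" by (simp add: r_def)
    have "- (of_int n * \<tau> * grid_point \<tau> P \<beta> (fst x)) + - (of_int n * \<tau> * grid_point \<tau> P \<beta> (fst y))
       = - (of_int n * \<tau> * (2 * \<beta>)) + - (2 * pi * of_int (n * (fst x + fst y)) / of_int P)"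
      using tau P0 by (simp add: grid_point_def field_simps)
    also have "- (2 * pi * of_int (n * (fst x + fst y)) / of_int P)
       = - (2 * pi * of_int (n * fst (add x y)) / of_int P) + 2 * pi * of_int (- n * r)"
      using P0 by (subst l) (simp add: add_def field_simps)
    finally have arg: "- (of_int n * \<tau> * grid_point \<tau> P \<beta> (fst x)) + - (of_int n * \<tau> * grid_point \<tau> P \<beta> (fst y))
       = - (of_int n * \<tau> * (2 * \<beta>)) + (- (2 * pi * of_int (n * fst (add x y)) / of_int P) + 2 * pi * of_int (- n * r))" .
    have "e n t x * e n t y = cis (- (of_int n * \<tau> * grid_point \<tau> P \<beta> (fst x)) + - (of_int n * \<tau> * grid_point \<tau> P \<beta> (fst y)))
       * cis (of_int (snd (add x y)) * t)"
      by (simp add: e_def add_def cis_mult algebra_simps)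
    also have "cis (- (of_int n * \<tau> * grid_point \<tau> P \<beta> (fst x)) + - (of_int n * \<tau> * grid_point \<tau> P \<beta> (fst y)))
      = cis (- (of_int n * \<tau> * (2 * \<beta>))) * (cis (- (2 * pi * of_int (n * fst (add x y)) / of_int P)) * cis (2 * pi * of_int (- n * r)))"
      unfolding arg by (simp only: cis_mult)
    also have "cis (2 * pi * of_int (- n * r)) = 1" by (rule cis_multiple_2pi) simp
    finally show ?thesis by (simp add: E_def mult.assoc)
  qed
  have quartic: "norm (\<Sum>k\<in>freqs K. \<Sum>l\<in>{0..<P}. A l k * cis (- (of_int n * \<tau> * grid_point \<tau> P \<beta> l)) * cis (of_int k * t)) ^ 4
      = (norm (\<Sum>q\<in>Q. h q * cis (- (2 * pi * of_int (n * fst q) / of_int P)) * cis (of_int (snd q) * t)))\<^sup>2" for n t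
  proof -
    have "(\<Sum>k\<in>freqs K. \<Sum>l\<in>{0..<P}. A l k * cis (- (of_int n * \<tau> * grid_point \<tau> P \<beta> l)) * cis (of_int k * t))
      = (\<Sum>x\<in>S. B x * e n t x)"
      by (simp add: S_def sum_Times_swap B_def e_def mult.assoc)
    moreover have "(\<Sum>x\<in>S. B x * e n t x) * (\<Sum>x\<in>S. B x * e n t x)
      = cis (- (of_int n * \<tau> * (2 * \<beta>))) * (\<Sum>q\<in>Q. h q * E n t q)"
    proof -
      have "(\<Sum>x\<in>S. B x * e n t x) * (\<Sum>x\<in>S. B x * e n t x)
         = (\<Sum>z\<in>S\<times>S. (B (fst z) * e n t (fst z)) * (B (snd z) * e n t (snd z)))"
        by (simp add: sum_product sum.cartesian_product case_prod_unfold)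
      also have "\<dots> = (\<Sum>z\<in>S\<times>S. cis (- (of_int n * \<tau> * (2 * \<beta>))) * (B (fst z) * B (snd z) * E n t (add (fst z) (snd z))))"
      proof (intro sum.cong refl)
        fix z
        have "(B (fst z) * e n t (fst z)) * (B (snd z) * e n t (snd z))
          = B (fst z) * B (snd z) * (e n t (fst z) * e n t (snd z))" by (simp only: mult_ac)
        then show "(B (fst z) * e n t (fst z)) * (B (snd z) * e n t (snd z))
          = cis (- (of_int n * \<tau> * (2 * \<beta>))) * (B (fst z) * B (snd z) * E n t (add (fst z) (snd z)))"
          unfolding ee by (simp only: mult_ac)
      qed
      also have "\<dots> = cis (- (of_int n * \<tau> * (2 * \<beta>))) * (\<Sum>z\<in>S\<times>S. B (fst z) * B (snd z) * E n t (add (fst z) (snd z)))"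
        by (simp add: sum_distrib_left)
      also have "(\<Sum>z\<in>S\<times>S. B (fst z) * B (snd z) * E n t (add (fst z) (snd z)))
         = (\<Sum>q\<in>Q. \<Sum>z\<in>{z \<in> S\<times>S. add (fst z) (snd z) = q}. B (fst z) * B (snd z) * E n t (add (fst z) (snd z)))"
        by (rule sum.group[symmetric]) (use finS finQ addQ in auto)
      also have "\<dots> = (\<Sum>q\<in>Q. h q * E n t q)"
      proof (rule sum.cong[OF refl])
        fix q
        have "{z \<in> S\<times>S. add (fst z) (snd z) = q} = {(x, y). x \<in> S \<and> y \<in> S \<and> add x y = q}" by auto
        then show "(\<Sum>z\<in>{z \<in> S\<times>S. add (fst z) (snd z) = q}. B (fst z) * B (snd z) * E n t (add (fst z) (snd z))) = h q * E n t q"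
          by (auto simp: h_def sum_distrib_right case_prod_unfold intro!: sum.cong)
      qed
      finally show ?thesis .
    qed
    then have "norm ((\<Sum>x\<in>S. B x * e n t x) * (\<Sum>x\<in>S. B x * e n t x)) = norm (\<Sum>q\<in>Q. h q * E n t q)"
      by (simp only: norm_mult norm_cis mult_1)
    then have "(norm (\<Sum>x\<in>S. B x * e n t x))\<^sup>2 = norm (\<Sum>q\<in>Q. h q * E n t q)"
      by (simp add: norm_mult power2_eq_square)
    then have "((norm (\<Sum>x\<in>S. B x * e n t x))\<^sup>2)\<^sup>2 = (norm (\<Sum>q\<in>Q. h q * E n t q))\<^sup>2"
      by simp
    ultimately show ?thesis by (simp add: E_def mult.assoc)
  qed
  have eq: "(\<Sum>n\<in>{a..<a+P}. integral {-pi..pi} (\<lambda>x. norm (\<Sum>k\<in>freqs K. \<Sum>l\<in>{0..<P}.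
        A l k * cis (- (of_int n * \<tau> * grid_point \<tau> P \<beta> l)) * cis (of_int k * x)) ^ 4))
     = 2 * pi * of_int P * (\<Sum>q\<in>Q. (norm (h q))\<^sup>2)"
    unfolding quartic Q_def by (rule plancherel_grid[OF P0 finJ])
  have le: "(\<Sum>q\<in>Q. (norm (h q))\<^sup>2) \<le> (\<Sum>q\<in>Q. (\<Sum>(x, y) | x \<in> S \<and> y \<in> S \<and> add x y = q. norm (B x) * norm (B y))\<^sup>2)"
  proof (intro sum_mono power_mono)
    fix q
    show "norm (h q) \<le> (\<Sum>(x, y) | x \<in> S \<and> y \<in> S \<and> add x y = q. norm (B x) * norm (B y))"
      unfolding h_def by (rule order_trans[OF norm_sum]) (simp add: case_prod_unfold norm_mult)
  qed auto
  define W where "W = (\<Sum>x\<in>S. 2 powr (3/4 * real (lev x)) * (norm (B x))\<^sup>2)"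
  have bil: "(\<Sum>q\<in>Q. (\<Sum>(x, y) | x \<in> S \<and> y \<in> S \<and> add x y = q. norm (B x) * norm (B y))\<^sup>2)
     \<le> (2 / (1 - 2 powr (- 1/8)))\<^sup>2 * (234 * (\<tau> * of_int P) * \<tau> * K\<^sup>2) * W\<^sup>2"
    unfolding W_def
  proof (rule dyadic_bilinear[OF finS finQ _ addQ])
    show "0 \<le> 234 * (\<tau> * of_int P) * \<tau> * K\<^sup>2" using tau P by simp
    show "real (card {(x, y). x \<in> S \<and> y \<in> S \<and> lev x = i \<and> lev y = j \<and> add x y = q})
      \<le> 234 * (\<tau> * of_int P) * \<tau> * K\<^sup>2 * 2 ^ min i j * 2 powr (real (max i j) / 2)" for i j q
      using card_level_fibre_le[OF tau K P, of \<beta> i j q] by (simp only: S_def lev_def add_def)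
  qed
  have W0: "0 \<le> W" by (auto simp: W_def intro!: sum_nonneg)
  have "W \<le> (\<Sum>x\<in>S. japanese (d_sym \<tau> (grid_point \<tau> P \<beta> (fst x) - (of_int (snd x))\<^sup>2)) powr (3/4) * (norm (B x))\<^sup>2)"
    unfolding W_def
  proof (intro sum_mono mult_right_mono)
    fix x
    define w where "w = japanese (d_sym \<tau> (grid_point \<tau> P \<beta> (fst x) - (of_int (snd x))\<^sup>2))"
    have "2 powr (3/4 * real (lev x)) = (2 ^ lev x) powr (3/4)"
      by (simp add: powr_realpow[symmetric] powr_powr mult.commute)
    also have "\<dots> \<le> w powr (3/4)"
      using dyadic_level_bounds(1)[OF one_le_japanese] by (intro powr_mono2) (auto simp: lev_def w_def)
    finally show "2 powr (3/4 * real (lev x)) \<le> japanese (d_sym \<tau> (grid_point \<tau> P \<beta> (fst x) - (of_int (snd x))\<^sup>2)) powr (3/4)"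
      by (simp only: w_def)
  qed auto
  also have "\<dots> = (\<Sum>k\<in>freqs K. \<Sum>l\<in>{0..<P}. japanese (d_sym \<tau> (grid_point \<tau> P \<beta> l - (of_int k)\<^sup>2)) powr (3/4)
         * (norm (A l k))\<^sup>2)"
    by (simp add: S_def sum_Times_swap B_def)
  finally have "W\<^sup>2 \<le> (\<Sum>k\<in>freqs K. \<Sum>l\<in>{0..<P}. japanese (d_sym \<tau> (grid_point \<tau> P \<beta> l - (of_int k)\<^sup>2)) powr (3/4)
         * (norm (A l k))\<^sup>2)\<^sup>2" (is "_ \<le> ?E\<^sup>2")
    using W0 by (rule power_mono)
  have "2 * pi * of_int P * (\<Sum>q\<in>Q. (norm (h q))\<^sup>2)
     \<le> 2 * pi * of_int P * ((2 / (1 - 2 powr (- 1/8)))\<^sup>2 * (234 * (\<tau> * of_int P) * \<tau> * K\<^sup>2) * ?E\<^sup>2)"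
  proof (rule mult_left_mono)
    show "(\<Sum>q\<in>Q. (norm (h q))\<^sup>2) \<le> (2 / (1 - 2 powr (- 1/8)))\<^sup>2 * (234 * (\<tau> * of_int P) * \<tau> * K\<^sup>2) * ?E\<^sup>2"
      by (rule order_trans[OF order_trans[OF le bil]], rule mult_left_mono[OF \<open>W\<^sup>2 \<le> ?E\<^sup>2\<close>])
        (use tau P in simp)
  qed (use P0 in simp)
  also have "\<dots> = strichartz_const * (of_int P * \<tau> * K)\<^sup>2 * ?E\<^sup>2"
    unfolding strichartz_const_def power_mult_distrib by (simp only: power2_eq_square[of \<tau>] power2_eq_square[of "real_of_int P"] mult_ac)
  finally show ?thesis unfolding eq .
qed

section \<open>From the grid to sequences of finite support\<close>

lemma integral_shift_real:
  fixes f :: "real \<Rightarrow> 'a::euclidean_space"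
  shows "integral {a + c..b + c} f = integral {a..b} (\<lambda>x. f (x + c))"
  using integral_shift_Icc_real[of a b f c] by (simp add: o_def add.commute)

text \<open>Both integrals differ from the integral over \<open>[a, b + T]\<close> by integrals over \<open>[a, b]\<close> and \<open>[a + T, b + T]\<close>, which
agree.\<close>

lemma integral_periodic_shift:
  fixes f :: "real \<Rightarrow> real"
  assumes cont: "continuous_on UNIV f" and T: "0 \<le> T" and per: "\<And>x. f (x + T) = f x"
  shows "integral {a..a + T} f = integral {b..b + T} f"
proof -
  have int: "f integrable_on {c..d}" for c d
    by (rule integrable_continuous_real) (rule continuous_on_subset[OF cont], simp)
  have "integral {a..a + T} f = integral {b..b + T} f" if "a \<le> b" for a b
  proof -
    have "integral {a..b} f + integral {b..b + T} f = integral {a..b + T} f"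
      by (rule Henstock_Kurzweil_Integration.integral_combine) (use that T int in auto)
    also have "\<dots> = integral {a..a + T} f + integral {a + T..b + T} f"
      by (rule Henstock_Kurzweil_Integration.integral_combine[symmetric]) (use that T int in auto)
    also have "integral {a + T..b + T} f = integral {a..b} f"
      by (simp add: integral_shift_real per)
    finally show ?thesis by simp
  qed
  from this[of a b] this[of b a] show ?thesis by linarith
qed

lemma integral_split_grid:
  fixes f :: "real \<Rightarrow> real"
  assumes cont: "continuous_on UNIV f" and h: "0 \<le> h"
  shows "integral {0..real m * h} f = integral {0..h} (\<lambda>x. \<Sum>l<m. f (x + real l * h))"
proof -
  have int: "f integrable_on {c..d}" for c d
    by (rule integrable_continuous_real) (rule continuous_on_subset[OF cont], simp)
  have "integral {0..real m * h} f = (\<Sum>l<m. integral {0..h} (\<lambda>x. f (x + real l * h)))"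
  proof (induction m)
    case (Suc m)
    have "integral {0..real (Suc m) * h} f = integral {0..real m * h} f + integral {real m * h..real (Suc m) * h} f"
      by (rule Henstock_Kurzweil_Integration.integral_combine[symmetric]) (use h int in \<open>auto simp: mult_right_mono\<close>)
    also have "integral {real m * h..real (Suc m) * h} f = integral {0..h} (\<lambda>x. f (x + real m * h))"
      using integral_shift_real[of 0 "real m * h" h] by (simp add: algebra_simps)
    finally show ?case using Suc by simp
  qed simp
  also have "\<dots> = integral {0..h} (\<lambda>x. \<Sum>l<m. f (x + real l * h))"
    by (rule Henstock_Kurzweil_Integration.integral_sum[symmetric])
      (auto intro!: integrable_continuous_real continuous_on_compose2[OF cont] continuous_intros)
  finally show ?thesis .
qed

text \<open>The integral over a period is the integral of the grid sum over all offsets in one cell, so the offset with the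
smallest grid sum does at most as badly as the average.\<close>

lemma exists_grid_sum_le_integral:
  fixes f :: "real \<Rightarrow> real" and P :: int
  assumes cont: "continuous_on UNIV f" and T: "0 < T" and P: "0 < P"
  shows "\<exists>\<beta>. (\<Sum>l\<in>{0..<P}. f (\<beta> + of_int l * (T / of_int P))) * (T / of_int P) \<le> integral {0..T} f"
proof -
  define h where "h = T / of_int P"
  have h: "0 < h" using T P by (simp add: h_def)
  define g where "g x = (\<Sum>l<nat P. f (x + real l * h))" for x
  have contg: "continuous_on {0..h} g"
    unfolding g_def by (intro continuous_intros continuous_on_compose2[OF cont]) auto
  obtain \<beta> where \<beta>: "\<beta> \<in> {0..h}" "\<And>x. x \<in> {0..h} \<Longrightarrow> g \<beta> \<le> g x"
    using continuous_attains_inf[OF _ _ contg] h by auto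
  have "g \<beta> * h = integral {0..h} (\<lambda>x. g \<beta>)" using h by simp
  also have "\<dots> \<le> integral {0..h} g"
    by (rule integral_le) (use \<beta> contg in \<open>auto intro: integrable_continuous_real\<close>)
  also have "\<dots> = integral {0..real (nat P) * h} f"
    unfolding g_def by (rule integral_split_grid[OF cont, symmetric]) (use h in simp)
  also have "real (nat P) * h = T" using P by (simp add: h_def)
  finally have "g \<beta> * h \<le> integral {0..T} f" .
  moreover have "g \<beta> = (\<Sum>l\<in>{0..<P}. f (\<beta> + of_int l * h))"
    using sum_int_interval_shift[of P "\<lambda>l. f (\<beta> + of_int l * h)" 0] P by (simp add: g_def)
  ultimately show ?thesis unfolding h_def by auto
qed

lemma d_sym_periodic: "\<tau> \<noteq> 0 \<Longrightarrow> d_sym \<tau> (\<sigma> + 2 * pi / \<tau>) = d_sym \<tau> \<sigma>"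
proof -
  assume "\<tau> \<noteq> 0"
  then have "\<tau> * (\<sigma> + 2 * pi / \<tau>) = \<tau> * \<sigma> + 2 * pi" by (simp add: field_simps)
  then have "cis (\<tau> * (\<sigma> + 2 * pi / \<tau>)) = cis (\<tau> * \<sigma>)" by (simp flip: cis_mult)
  then show ?thesis by (simp only: d_sym_def cis_conv_exp of_real_mult mult.assoc)
qed

lemma continuous_on_japanese_powr [continuous_intros]:
  fixes f :: "'a::topological_space \<Rightarrow> 'b::real_normed_vector"
  assumes "continuous_on A f"
  shows "continuous_on A (\<lambda>x. japanese (f x) powr b)"
proof -
  have "1 + (norm (f x))\<^sup>2 \<noteq> 0" for x by (smt (verit) zero_le_power2)
  then have "continuous_on A (\<lambda>x. japanese (f x))"
    unfolding japanese_def by (intro continuous_intros assms) auto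
  moreover have "japanese (f x) \<noteq> 0" for x using one_le_japanese[of "f x"] by auto
  ultimately show ?thesis by (intro continuous_intros) auto
qed

lemma continuous_on_d_sym [continuous_intros]: "continuous_on A (d_sym \<tau>)"
  unfolding d_sym_def[abs_def] divide_inverse by (intro continuous_intros)

text \<open>The transform \<open>\<F>\<^sub>\<tau>\<close> of the sequence \<open>c\<close> truncated to \<open>\<bar>m\<bar> \<le> N\<close>.\<close>

definition time_poly :: "real \<Rightarrow> nat \<Rightarrow> (int \<Rightarrow> complex) \<Rightarrow> real \<Rightarrow> complex" where
  "time_poly \<tau> N c \<sigma> = of_real \<tau> * (\<Sum>m=-int N..int N. c m * cis (of_int m * \<tau> * \<sigma>))"

lemma continuous_on_cis_compose [continuous_intros]:
  "continuous_on A f \<Longrightarrow> continuous_on A (\<lambda>x. cis (f x))"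
  unfolding cis_conv_exp by (intro continuous_intros)

lemma continuous_on_time_poly [continuous_intros]: "continuous_on A (time_poly \<tau> N c)"
  unfolding time_poly_def[abs_def] by (intro continuous_intros)

lemma time_poly_periodic:
  assumes "\<tau> \<noteq> 0"
  shows "time_poly \<tau> N c (\<sigma> + 2 * pi / \<tau>) = time_poly \<tau> N c \<sigma>"
proof -
  have "cis (of_int m * \<tau> * (\<sigma> + 2 * pi / \<tau>)) = cis (of_int m * \<tau> * \<sigma>)" for m
  proof -
    have "of_int m * \<tau> * (\<sigma> + 2 * pi / \<tau>) = of_int m * \<tau> * \<sigma> + 2 * pi * of_int m"
      using assms by (simp add: field_simps)
    then show ?thesis by (simp flip: cis_mult)
  qed
  then show ?thesis by (simp only: time_poly_def)
qed

text \<open>Because \<open>P\<close> exceeds every difference \<open>m - n\<close> of two times, a grid with \<open>P\<close> points integrates the products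
that occur here exactly, whatever its offset.  The shift by \<open>y\<close> moves a modulation by \<open>y\<close> from the sequence to the
evaluation points.\<close>

lemma grid_inversion:
  fixes P k :: int
  assumes tau: "0 < \<tau>" and P: "2 * int N < P" and n: "n \<in> {- int N..int N}"
  shows "(\<Sum>l\<in>{0..<P}. time_poly \<tau> N c (grid_point \<tau> P \<beta> l - y) * cis (- (of_int n * \<tau> * grid_point \<tau> P \<beta> l)))
    = of_real \<tau> * of_int P * (c n * cis (- (of_int n * \<tau> * y)))"
proof -
  have P0: "0 < P" using P by simp
  have "(\<Sum>l\<in>{0..<P}. time_poly \<tau> N c (grid_point \<tau> P \<beta> l - y) * cis (- (of_int n * \<tau> * grid_point \<tau> P \<beta> l)))
     = (\<Sum>l\<in>{0..<P}. \<Sum>m=-int N..int N. of_real \<tau> * (c m * cis (- (of_int m * \<tau> * y)) * cis (of_int (m - n) * \<tau> * \<beta>))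
          * cis (2 * pi * of_int (l * (m - n)) / of_int P))"
    unfolding time_poly_def sum_distrib_left sum_distrib_right
  proof (intro sum.cong refl)
    fix l m :: int
    have "of_int m * \<tau> * (grid_point \<tau> P \<beta> l - y) + - (of_int n * \<tau> * grid_point \<tau> P \<beta> l)
       = - (of_int m * \<tau> * y) + of_int (m - n) * \<tau> * \<beta> + 2 * pi * of_int (l * (m - n)) / of_int P"
      using tau P0 by (simp add: grid_point_def field_simps)
    then have "cis (of_int m * \<tau> * (grid_point \<tau> P \<beta> l - y)) * cis (- (of_int n * \<tau> * grid_point \<tau> P \<beta> l))
       = cis (- (of_int m * \<tau> * y)) * cis (of_int (m - n) * \<tau> * \<beta>) * cis (2 * pi * of_int (l * (m - n)) / of_int P)"
      by (simp only: cis_mult)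
    then show "of_real \<tau> * (c m * cis (of_int m * \<tau> * (grid_point \<tau> P \<beta> l - y))) * cis (- (of_int n * \<tau> * grid_point \<tau> P \<beta> l))
      = of_real \<tau> * (c m * cis (- (of_int m * \<tau> * y)) * cis (of_int (m - n) * \<tau> * \<beta>)) * cis (2 * pi * of_int (l * (m - n)) / of_int P)"
      by (simp only: mult.assoc)
  qed
  also have "\<dots> = (\<Sum>m=-int N..int N. of_real \<tau> * (c m * cis (- (of_int m * \<tau> * y)) * cis (of_int (m - n) * \<tau> * \<beta>))
          * (\<Sum>l\<in>{0..<0+P}. cis (2 * pi * of_int (l * (m - n)) / of_int P)))"
    unfolding sum_distrib_left by (subst sum.swap) simp
  also have "\<dots> = (\<Sum>m=-int N..int N. if m = n then of_real \<tau> * of_int P * (c n * cis (- (of_int n * \<tau> * y))) else 0)"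
  proof (intro sum.cong refl)
    fix m assume m: "m \<in> {- int N..int N}"
    have "P dvd (m - n) \<longleftrightarrow> m = n"
    proof
      assume "P dvd (m - n)"
      show "m = n"
      proof (rule ccontr)
        assume "m \<noteq> n"
        then have "\<bar>P\<bar> \<le> \<bar>m - n\<bar>" using \<open>P dvd (m - n)\<close> by (intro dvd_imp_le_int) auto
        with m n P show False by auto
      qed
    qed simp
    then show "of_real \<tau> * (c m * cis (- (of_int m * \<tau> * y)) * cis (of_int (m - n) * \<tau> * \<beta>))
          * (\<Sum>l\<in>{0..<0+P}. cis (2 * pi * of_int (l * (m - n)) / of_int P))
       = (if m = n then of_real \<tau> * of_int P * (c n * cis (- (of_int n * \<tau> * y))) else 0)"
      unfolding sum_cis_residues[OF P0] by simp
  qed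
  also have "\<dots> = of_real \<tau> * of_int P * (c n * cis (- (of_int n * \<tau> * y)))" using n by simp
  finally show ?thesis .
qed

text \<open>Sampling the transform of \<open>V n k\<close> at \<open>s - k\<^sup>2\<close> for \<open>s\<close> in the grid gives, after division by \<open>\<tau> P\<close>, coefficients \<open>A l k\<close> whose
exponential sum is \<open>V n k exp(- i n \<tau> k\<^sup>2)\<close> for \<open>\<bar>n\<bar> \<le> N\<close>, so \<open>grid_strichartz\<close> applies.  The offset of the
grid is chosen such that the weighted integral controls the weighted sum of \<open>\<bar>A l k\<bar>\<^sup>2\<close>; by periodicity
the shifts by \<open>k\<^sup>2\<close> do not affect that integral.\<close>

lemma truncated_strichartz:
  fixes \<tau> K :: real and N :: nat and V :: "int \<Rightarrow> int \<Rightarrow> complex"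
  assumes tau: "0 < \<tau>" "\<tau> \<le> 1" and K: "1 \<le> K\<^sup>2 * \<tau>"
  shows "(\<Sum>n=-int N..int N. integral {-pi..pi} (\<lambda>x. norm (\<Sum>k\<in>freqs K.
        V n k * cis (- (of_int n * \<tau> * (of_int k)\<^sup>2)) * cis (of_int k * x)) ^ 4))
    \<le> strichartz_const * K\<^sup>2 * (\<Sum>k\<in>freqs K. integral {-pi/\<tau>..pi/\<tau>}
         (\<lambda>\<sigma>. japanese (d_sym \<tau> \<sigma>) powr (3/4) * (norm (time_poly \<tau> N (\<lambda>n. V n k) \<sigma>))\<^sup>2))\<^sup>2"
proof -
  \<comment> \<open>The grid must separate the times \<open>-N..N\<close> and have mesh at most \<open>2 \<pi>\<close>.\<close>
  define P where "P = 2 * int N + 1 + \<lceil>1 / \<tau>\<rceil>"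
  have cl: "1 / \<tau> \<le> of_int \<lceil>1 / \<tau>\<rceil>" by (rule le_of_int_ceiling)
  then have cl0: "0 < \<lceil>1 / \<tau>\<rceil>" using tau by simp
  have P0: "0 < P" and PN: "2 * int N < P" using cl0 unfolding P_def by linarith+
  have Ptau: "1 \<le> \<tau> * of_int P"
  proof -
    have "0 \<le> real_of_int (2 * int N + 1)" by simp
    with cl have "1 / \<tau> \<le> of_int P"
      unfolding P_def of_int_add[of "2 * int N + 1"] by linarith
    then show ?thesis using tau by (simp add: field_simps)
  qed
  define F where "F k = time_poly \<tau> N (\<lambda>n. V n k)" for k
  define G where "G k \<sigma> = japanese (d_sym \<tau> \<sigma>) powr (3/4) * (norm (F k \<sigma>))\<^sup>2" for k \<sigma>
  define E where "E = (\<Sum>k\<in>freqs K. integral {-pi/\<tau>..pi/\<tau>} (G k))"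
  have contG: "continuous_on UNIV (G k)" for k
    unfolding G_def F_def by (intro continuous_intros)
  have contG': "continuous_on A (\<lambda>s. G k (s - c))" for A k c
    by (rule continuous_on_compose2[OF contG]) (auto intro!: continuous_intros)
  have G0: "0 \<le> G k \<sigma>" for k \<sigma> by (simp add: G_def)
  have intG: "integral {0..2 * pi / \<tau>} (\<lambda>s. G k (s - c)) = integral {-pi/\<tau>..pi/\<tau>} (G k)" for k c
  proof -
    have "integral {0..2 * pi / \<tau>} (\<lambda>s. G k (s - c)) = integral {- c..- c + 2 * pi / \<tau>} (G k)"
      using integral_shift_real[of 0 "- c" "2 * pi / \<tau>" "G k"] by (simp add: add.commute)
    also have "\<dots> = integral {-pi/\<tau>..-pi/\<tau> + 2 * pi / \<tau>} (G k)"
      by (rule integral_periodic_shift[OF contG])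
        (use tau in \<open>auto simp: G_def F_def d_sym_periodic time_poly_periodic\<close>)
    also have "-pi/\<tau> + 2 * pi / \<tau> = pi / \<tau>" by (simp add: field_simps)
    finally show ?thesis .
  qed
  obtain \<beta> where \<beta>: "(\<Sum>l\<in>{0..<P}. \<Sum>k\<in>freqs K. G k (\<beta> + of_int l * (2 * pi / \<tau> / of_int P) - (of_int k)\<^sup>2)) * (2 * pi / \<tau> / of_int P)
      \<le> integral {0..2 * pi / \<tau>} (\<lambda>s. \<Sum>k\<in>freqs K. G k (s - (of_int k)\<^sup>2))"
  proof -
    have "continuous_on UNIV (\<lambda>s. \<Sum>k\<in>freqs K. G k (s - (of_int k)\<^sup>2))"
      by (intro continuous_on_sum contG')
    from exists_grid_sum_le_integral[OF this _ P0, of "2 * pi / \<tau>"] tau that show ?thesis by fastforce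
  qed
  have "integral {0..2 * pi / \<tau>} (\<lambda>s. \<Sum>k\<in>freqs K. G k (s - (of_int k)\<^sup>2))
     = (\<Sum>k\<in>freqs K. integral {0..2 * pi / \<tau>} (\<lambda>s. G k (s - (of_int k)\<^sup>2)))"
    by (rule Henstock_Kurzweil_Integration.integral_sum)
      (auto intro!: integrable_continuous_real contG')
  then have eqE: "integral {0..2 * pi / \<tau>} (\<lambda>s. \<Sum>k\<in>freqs K. G k (s - (of_int k)\<^sup>2)) = E"
    by (simp add: intG E_def)
  define A where "A l k = F k (grid_point \<tau> P \<beta> l - (of_int k)\<^sup>2) / (of_real \<tau> * of_int P)" for l k
  \<comment> \<open>The weighted energy of \<open>A\<close> before normalization; the choice of \<open>\<beta>\<close> bounds it by \<open>E\<close> divided by the mesh.\<close>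
  define D where "D = (\<Sum>k\<in>freqs K. \<Sum>l\<in>{0..<P}. G k (grid_point \<tau> P \<beta> l - (of_int k)\<^sup>2))"
  have D: "D * (2 * pi / (\<tau> * of_int P)) \<le> E"
    using \<beta> unfolding eqE D_def by (subst sum.swap) (simp add: grid_point_def)
  have D0: "0 \<le> D" by (auto simp: D_def intro!: sum_nonneg G0)
  have E0: "0 \<le> E" using D0 D tau P0 by (smt (verit) mult_nonneg_nonneg divide_nonneg_nonneg of_int_0_le_iff pi_ge_zero)
  have energy: "(\<Sum>k\<in>freqs K. \<Sum>l\<in>{0..<P}. japanese (d_sym \<tau> (grid_point \<tau> P \<beta> l - (of_int k)\<^sup>2)) powr (3/4)
         * (norm (A l k))\<^sup>2) = D / (\<tau> * of_int P)\<^sup>2"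
    using tau P0 by (simp add: D_def A_def G_def norm_divide norm_mult power_divide sum_divide_distrib)
  have field: "(\<Sum>l\<in>{0..<P}. A l k * cis (- (of_int n * \<tau> * grid_point \<tau> P \<beta> l)))
      = V n k * cis (- (of_int n * \<tau> * (of_int k)\<^sup>2))" if "n \<in> {- int N..int N}" for n k
    using grid_inversion[OF tau(1) PN that, of "\<lambda>n. V n k" \<beta> "(of_int k)\<^sup>2"] tau P0
    by (simp add: A_def F_def times_divide_eq_left flip: sum_divide_distrib)
  define I where "I n = integral {-pi..pi} (\<lambda>x. norm (\<Sum>k\<in>freqs K. \<Sum>l\<in>{0..<P}.
        A l k * cis (- (of_int n * \<tau> * grid_point \<tau> P \<beta> l)) * cis (of_int k * x)) ^ 4)" for n
  have "(\<Sum>n=-int N..int N. integral {-pi..pi} (\<lambda>x. norm (\<Sum>k\<in>freqs K.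
        V n k * cis (- (of_int n * \<tau> * (of_int k)\<^sup>2)) * cis (of_int k * x)) ^ 4)) = (\<Sum>n=-int N..int N. I n)"
    unfolding I_def by (intro sum.cong refl) (simp only: sum_distrib_right[symmetric] field)
  also have "\<dots> \<le> (\<Sum>n\<in>{- int N..<- int N + P}. I n)"
    by (rule sum_mono2) (use PN in \<open>auto simp: I_def intro!: integral_nonneg integrable_continuous_real continuous_intros\<close>)
  also have "\<dots> \<le> strichartz_const * (of_int P * \<tau> * K)\<^sup>2 * (D / (\<tau> * of_int P)\<^sup>2)\<^sup>2"
    using grid_strichartz[OF tau K Ptau, where a = "- int N" and \<beta> = \<beta> and A = A] unfolding I_def energy .
  also have "\<dots> = strichartz_const * K\<^sup>2 * (D / (\<tau> * of_int P))\<^sup>2"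
    using tau P0 by (simp add: power_mult_distrib power_divide field_simps power2_eq_square)
  also have "\<dots> \<le> strichartz_const * K\<^sup>2 * E\<^sup>2"
  proof (intro mult_left_mono power_mono)
    have "D / (\<tau> * of_int P) \<le> D / (\<tau> * of_int P) * (2 * pi)"
      using D0 tau P0 pi_gt3 mult_left_mono[of 1 "2 * pi" "D / (\<tau> * of_int P)"] by simp
    with D show "D / (\<tau> * of_int P) \<le> E" by simp
  qed (use D0 tau P0 strichartz_const_pos in auto)
  finally show ?thesis unfolding E_def G_def[abs_def] F_def .
qed

section \<open>Square integrable functions and the Fourier transform in time\<close>

text \<open>The square of the \<open>L\<^sup>2\<close> norm; working with it keeps \<open>epowr\<close> out of the limit argument.\<close>

definition L2sq :: "(real \<Rightarrow> complex) \<Rightarrow> ennreal" where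
  "L2sq f = (\<integral>\<^sup>+x\<in>{-pi..pi}. ennreal ((norm (f x))\<^sup>2) \<partial>lborel)"

lemma epowr_cancel:
  assumes "0 < p"
  shows "epowr (epowr a (1 / p)) p = a"
  using assms by (cases a) (auto simp: epowr_def powr_powr)

lemma epowr_mono:
  assumes "a \<le> b" "0 \<le> p"
  shows "epowr a p \<le> epowr b p"
proof (cases "b = top")
  case False
  with assms(1) have "a < top" "b < top" by (auto simp: less_top[symmetric] top_unique)
  with assms show ?thesis
    by (auto simp: epowr_def intro!: ennreal_leI powr_mono2 enn2real_mono)
qed (simp add: epowr_def)

lemma Lp_norm_2: "Lp_norm 2 f = epowr (L2sq f) (1 / 2)"
  by (simp add: Lp_norm_def L2sq_def)

lemma torus_L2D:
  assumes "torus_L2 f"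
  shows "f \<in> borel_measurable borel" "L2sq f < top"
  using assms by (auto simp: torus_L2_def torus_fun_def Lp_norm_2 epowr_def less_top split: if_splits)

lemma set_integrable_L2sq:
  assumes f: "f \<in> borel_measurable borel" and fin: "L2sq f < top"
  shows "set_integrable lborel {-pi..pi} (\<lambda>x. (norm (f x))\<^sup>2)"
    and "ennreal (LINT x:{-pi..pi}|lborel. (norm (f x))\<^sup>2) = L2sq f"
proof -
  note [measurable] = f
  have eq: "(\<integral>\<^sup>+x. ennreal (norm (indicator {-pi..pi} x *\<^sub>R (norm (f x))\<^sup>2)) \<partial>lborel) = L2sq f"
    unfolding L2sq_def by (intro nn_integral_cong) (auto simp: indicator_def)
  show int: "set_integrable lborel {-pi..pi} (\<lambda>x. (norm (f x))\<^sup>2)"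
    unfolding set_integrable_def
    by (rule integrableI_bounded) (use eq fin in \<open>simp_all add: less_top\<close>)
  have "(\<integral>\<^sup>+x. ennreal (indicator {-pi..pi} x *\<^sub>R (norm (f x))\<^sup>2) \<partial>lborel)
      = ennreal (LINT x:{-pi..pi}|lborel. (norm (f x))\<^sup>2)"
    unfolding set_lebesgue_integral_def
    by (rule nn_integral_eq_integral) (use int in \<open>auto simp: set_integrable_def\<close>)
  moreover have "(\<integral>\<^sup>+x. ennreal (indicator {-pi..pi} x *\<^sub>R (norm (f x))\<^sup>2) \<partial>lborel) = L2sq f"
    unfolding L2sq_def by (intro nn_integral_cong) (auto simp: indicator_def)
  ultimately show "ennreal (LINT x:{-pi..pi}|lborel. (norm (f x))\<^sup>2) = L2sq f" by simp
qed

lemma set_integrable_torus_L2: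
  assumes f: "f \<in> borel_measurable borel" and fin: "L2sq f < top"
    and g: "g \<in> borel_measurable borel" "\<And>x. norm (g x) \<le> B"
  shows "set_integrable lborel {-pi..pi} (\<lambda>x. f x * g x)"
proof -
  note [measurable] = f g(1)
  have "set_integrable lborel {-pi..pi} (\<lambda>x. B * (1 + (norm (f x))\<^sup>2))"
    by (intro set_integral_add set_integrable_mult_right set_integrable_L2sq[OF f fin] impI)
      (simp add: set_integrable_def)
  then show ?thesis
    unfolding set_integrable_def
  proof (rule Bochner_Integration.integrable_bound)
    show "AE x in lborel. norm (indicator {-pi..pi} x *\<^sub>R (f x * g x)) \<le> norm (indicator {-pi..pi} x *\<^sub>R (B * (1 + (norm (f x))\<^sup>2)))"
    proof (intro always_eventually allI)
      fix x
      have B: "0 \<le> B" using g(2)[of x] norm_ge_zero order_trans by blast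
      have "norm (f x) \<le> 1 + (norm (f x))\<^sup>2"
        using sum_squares_bound[of "norm (f x)" 1] norm_ge_zero[of "f x"]
        unfolding power_one mult_1_right by linarith
      then have "norm (f x * g x) \<le> (1 + (norm (f x))\<^sup>2) * B"
        unfolding norm_mult by (intro mult_mono g(2)) auto
      then show "norm (indicator {-pi..pi} x *\<^sub>R (f x * g x)) \<le> norm (indicator {-pi..pi} x *\<^sub>R (B * (1 + (norm (f x))\<^sup>2)))"
        using B by (auto simp: indicator_def abs_mult mult.commute)
    qed
  qed simp
qed

lemma fourier_coeff_cis:
  "fourier_coeff f k = (LINT x:{-pi..pi}|lborel. f x * cis (- (of_int k * x))) / (2 * of_real pi)"
  by (simp add: fourier_coeff_def cis_conv_exp mult.assoc)

lemma borel_measurable_cis [measurable (raw)]: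
  "f \<in> borel_measurable M \<Longrightarrow> (\<lambda>x. cis (f x)) \<in> borel_measurable M"
  by (rule borel_measurable_continuous_on[where f = cis]) (auto intro!: continuous_intros)

lemma set_integrable_continuous_Icc:
  fixes f :: "real \<Rightarrow> 'a::{banach, second_countable_topology}"
  assumes "continuous_on {a..b} f"
  shows "set_integrable lborel {a..b} f"
  unfolding set_integrable_def by (rule borel_integrable_compact) (use assms in auto)

lemma set_nn_integral_continuous:
  fixes f :: "real \<Rightarrow> real"
  assumes cont: "continuous_on {a..b} f" and nonneg: "\<And>x. 0 \<le> f x"
  shows "(\<integral>\<^sup>+x\<in>{a..b}. ennreal (f x) \<partial>lborel) = ennreal (integral {a..b} f)"
proof -
  note int = set_integrable_continuous_Icc[OF cont]
  have "(\<integral>\<^sup>+x\<in>{a..b}. ennreal (f x) \<partial>lborel) = (\<integral>\<^sup>+x. ennreal (indicator {a..b} x *\<^sub>R f x) \<partial>lborel)"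
    by (intro nn_integral_cong) (auto simp: indicator_def)
  also have "\<dots> = ennreal (LINT x:{a..b}|lborel. f x)"
    unfolding set_lebesgue_integral_def
    by (rule nn_integral_eq_integral) (use int nonneg in \<open>auto simp: set_integrable_def\<close>)
  also have "(LINT x:{a..b}|lborel. f x) = integral {a..b} f"
    by (rule set_borel_integral_eq_integral(2)[OF int])
  finally show ?thesis .
qed

lemma
  fixes f :: "'i \<Rightarrow> 'a \<Rightarrow> 'b::{banach, second_countable_topology}"
  assumes "\<And>i. i \<in> I \<Longrightarrow> set_integrable M A (f i)"
  shows set_integrable_finite_sum: "set_integrable M A (\<lambda>x. \<Sum>i\<in>I. f i x)"
    and set_integral_finite_sum: "(LINT x:A|M. (\<Sum>i\<in>I. f i x)) = (\<Sum>i\<in>I. LINT x:A|M. f i x)"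
  using assms unfolding set_integrable_def set_lebesgue_integral_def scaleR_sum_right
  by (auto intro!: Bochner_Integration.integrable_sum Bochner_Integration.integral_sum)

text \<open>Integrate \<open>\<bar>f - p\<bar>\<^sup>2 \<ge> 0\<close>, where \<open>p\<close> is the partial Fourier sum over \<open>J\<close>.\<close>

lemma bessel:
  assumes f: "f \<in> borel_measurable borel" and J: "finite J"
  shows "ennreal (2 * pi * (\<Sum>k\<in>J. (norm (fourier_coeff f k))\<^sup>2)) \<le> L2sq f"
proof (cases "L2sq f < top")
  case True
  note [measurable] = f
  define c where "c k = fourier_coeff f k" for k
  define p where "p x = (\<Sum>k\<in>J. c k * cis (of_int k * x))" for x :: real
  note fsq = set_integrable_L2sq[OF f True]
  have fcis: "set_integrable lborel {-pi..pi} (\<lambda>x. f x * cis (- (of_int k * x)))" for k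
    by (rule set_integrable_torus_L2[OF f True, where B = 1]) auto
  have fp: "f x * cnj (p x) = (\<Sum>k\<in>J. cnj (c k) * (f x * cis (- (of_int k * x))))" for x
    by (simp add: p_def cis_cnj sum_distrib_left mult_ac)
  have ifp: "set_integrable lborel {-pi..pi} (\<lambda>x. f x * cnj (p x))"
    unfolding fp by (intro set_integrable_finite_sum set_integrable_mult_right fcis)
  have vfp: "(LINT x:{-pi..pi}|lborel. f x * cnj (p x)) = of_real (2 * pi * (\<Sum>k\<in>J. (norm (c k))\<^sup>2))"
  proof -
    have "(LINT x:{-pi..pi}|lborel. f x * cnj (p x))
        = (\<Sum>k\<in>J. cnj (c k) * (LINT x:{-pi..pi}|lborel. f x * cis (- (of_int k * x))))"
      unfolding fp using fcis
      by (subst set_integral_finite_sum) (auto intro!: set_integrable_mult_right)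
    also have "\<dots> = (\<Sum>k\<in>J. cnj (c k) * (2 * of_real pi * c k))"
      by (simp add: c_def fourier_coeff_cis)
    also have "\<dots> = of_real (2 * pi * (\<Sum>k\<in>J. (norm (c k))\<^sup>2))"
      unfolding of_real_mult of_real_sum complex_norm_square sum_distrib_left
      by (intro sum.cong refl) simp
    finally show ?thesis .
  qed
  have contp: "continuous_on {-pi..pi} (\<lambda>x. (norm (p x))\<^sup>2)"
    unfolding p_def by (intro continuous_intros)
  note ip = set_integrable_continuous_Icc[OF contp]
  have vp: "(LINT x:{-pi..pi}|lborel. (norm (p x))\<^sup>2) = 2 * pi * (\<Sum>k\<in>J. (norm (c k))\<^sup>2)"
    unfolding set_borel_integral_eq_integral(2)[OF ip]
    unfolding p_def by (rule integral_unique[OF has_integral_norm_sum_cis[OF J]])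
  have ire: "set_integrable lborel {-pi..pi} (\<lambda>x. Re (f x * cnj (p x)))"
    using integrable_Re[OF ifp[unfolded set_integrable_def]] by (simp add: set_integrable_def)
  have vre: "(LINT x:{-pi..pi}|lborel. Re (f x * cnj (p x))) = 2 * pi * (\<Sum>k\<in>J. (norm (c k))\<^sup>2)"
    using arg_cong[OF vfp, of Re] integral_Re[OF ifp[unfolded set_integrable_def]]
    by (simp add: set_lebesgue_integral_def)
  have "0 \<le> (LINT x:{-pi..pi}|lborel. (norm (f x))\<^sup>2 - 2 * Re (f x * cnj (p x)) + (norm (p x))\<^sup>2)"
    unfolding set_lebesgue_integral_def
  proof (rule Bochner_Integration.integral_nonneg)
    fix x
    have "(norm (f x))\<^sup>2 - 2 * Re (f x * cnj (p x)) + (norm (p x))\<^sup>2 = (norm (f x - p x))\<^sup>2"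
      unfolding cmod_power2 by (simp add: power2_eq_square algebra_simps)
    then show "0 \<le> indicator {-pi..pi} x *\<^sub>R ((norm (f x))\<^sup>2 - 2 * Re (f x * cnj (p x)) + (norm (p x))\<^sup>2)"
      by simp
  qed
  also have "\<dots> = (LINT x:{-pi..pi}|lborel. (norm (f x))\<^sup>2) - 2 * (LINT x:{-pi..pi}|lborel. Re (f x * cnj (p x)))
      + (LINT x:{-pi..pi}|lborel. (norm (p x))\<^sup>2)"
  proof -
    have i2: "set_integrable lborel {-pi..pi} (\<lambda>x. 2 * Re (f x * cnj (p x)))"
      by (intro set_integrable_mult_right impI ire)
    show ?thesis
      unfolding set_integral_add(2)[OF set_integral_diff(1)[OF fsq(1) i2] ip] set_integral_diff(2)[OF fsq(1) i2]
      by (simp only: set_integral_mult_right)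
  qed
  finally have "2 * pi * (\<Sum>k\<in>J. (norm (c k))\<^sup>2) \<le> (LINT x:{-pi..pi}|lborel. (norm (f x))\<^sup>2)"
    unfolding vre vp by simp
  from ennreal_leI[OF this] show ?thesis unfolding fsq(2) c_def .
next
  case False
  then show ?thesis by (simp add: less_top[symmetric])
qed

lemma fourier_coeff_time_poly:
  assumes "\<And>m. f m \<in> borel_measurable borel" "\<And>m. L2sq (f m) < top"
  shows "fourier_coeff (\<lambda>x. time_poly \<tau> N (\<lambda>m. f m x) \<sigma>) k = time_poly \<tau> N (\<lambda>m. fourier_coeff (f m) k) \<sigma>"
proof -
  have int: "set_integrable lborel {-pi..pi} (\<lambda>x. f m x * cis (- (of_int k * x)))" for m
    by (rule set_integrable_torus_L2[OF assms, where B = 1]) auto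
  have "(LINT x:{-pi..pi}|lborel. time_poly \<tau> N (\<lambda>m. f m x) \<sigma> * cis (- (of_int k * x)))
     = (LINT x:{-pi..pi}|lborel. (\<Sum>m=-int N..int N. of_real \<tau> * cis (of_int m * \<tau> * \<sigma>) * (f m x * cis (- (of_int k * x)))))"
    by (simp add: time_poly_def sum_distrib_left sum_distrib_right mult_ac)
  also have "\<dots> = (\<Sum>m=-int N..int N. of_real \<tau> * cis (of_int m * \<tau> * \<sigma>) * (LINT x:{-pi..pi}|lborel. f m x * cis (- (of_int k * x))))"
    by (subst set_integral_finite_sum) (auto intro!: set_integrable_mult_right int)
  finally show ?thesis
    by (simp add: fourier_coeff_cis time_poly_def sum_distrib_left sum_divide_distrib mult_ac)
qed

text \<open>The integral in which \<open>has_time_fourier\<close> measures convergence.\<close>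

definition box_int :: "real \<Rightarrow> (real \<Rightarrow> real \<Rightarrow> ennreal) \<Rightarrow> ennreal" where
  "box_int \<tau> f = (\<integral>\<^sup>+\<sigma>\<in>{-pi/\<tau>..pi/\<tau>}. (\<integral>\<^sup>+x\<in>{-pi..pi}. f \<sigma> x \<partial>lborel) \<partial>lborel)"

lemma box_int_mono: "(\<And>\<sigma> x. f \<sigma> x \<le> g \<sigma> x) \<Longrightarrow> box_int \<tau> f \<le> box_int \<tau> g"
  unfolding box_int_def by (intro nn_integral_mono mult_right_mono) auto

lemma box_int_add:
  assumes [measurable]: "case_prod f \<in> borel_measurable (lborel \<Otimes>\<^sub>M lborel)"
    "case_prod g \<in> borel_measurable (lborel \<Otimes>\<^sub>M lborel)"
  shows "box_int \<tau> (\<lambda>\<sigma> x. f \<sigma> x + g \<sigma> x) = box_int \<tau> f + box_int \<tau> g"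
  unfolding box_int_def by (simp add: distrib_right nn_integral_add)

lemma box_int_cmult:
  assumes [measurable]: "case_prod f \<in> borel_measurable (lborel \<Otimes>\<^sub>M lborel)"
  shows "box_int \<tau> (\<lambda>\<sigma> x. c * f \<sigma> x) = c * box_int \<tau> f"
  unfolding box_int_def by (simp add: nn_integral_cmult mult.assoc)

lemma box_int_swap:
  assumes [measurable]: "case_prod f \<in> borel_measurable (lborel \<Otimes>\<^sub>M lborel)"
  shows "box_int \<tau> f = (\<integral>\<^sup>+x\<in>{-pi..pi}. (\<integral>\<^sup>+\<sigma>\<in>{-pi/\<tau>..pi/\<tau>}. f \<sigma> x \<partial>lborel) \<partial>lborel)"
proof -
  have "box_int \<tau> f = (\<integral>\<^sup>+\<sigma>. (\<integral>\<^sup>+x. f \<sigma> x * indicator {-pi..pi} x * indicator {-pi/\<tau>..pi/\<tau>} \<sigma> \<partial>lborel) \<partial>lborel)"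
    unfolding box_int_def by (simp add: nn_integral_multc)
  also have "\<dots> = (\<integral>\<^sup>+x. (\<integral>\<^sup>+\<sigma>. f \<sigma> x * indicator {-pi..pi} x * indicator {-pi/\<tau>..pi/\<tau>} \<sigma> \<partial>lborel) \<partial>lborel)"
    by (rule lborel_pair.Fubini') measurable
  also have "\<dots> = (\<integral>\<^sup>+x\<in>{-pi..pi}. (\<integral>\<^sup>+\<sigma>\<in>{-pi/\<tau>..pi/\<tau>}. f \<sigma> x \<partial>lborel) \<partial>lborel)"
  proof (intro nn_integral_cong)
    fix x
    have "(\<integral>\<^sup>+\<sigma>. f \<sigma> x * indicator {-pi..pi} x * indicator {-pi/\<tau>..pi/\<tau>} \<sigma> \<partial>lborel)
       = (\<integral>\<^sup>+\<sigma>. (f \<sigma> x * indicator {-pi/\<tau>..pi/\<tau>} \<sigma>) * indicator {-pi..pi} x \<partial>lborel)"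
      by (intro nn_integral_cong) (simp only: mult_ac)
    also have "\<dots> = (\<integral>\<^sup>+\<sigma>\<in>{-pi/\<tau>..pi/\<tau>}. f \<sigma> x \<partial>lborel) * indicator {-pi..pi} x"
      by (rule nn_integral_multc) measurable
    finally show "(\<integral>\<^sup>+\<sigma>. f \<sigma> x * indicator {-pi..pi} x * indicator {-pi/\<tau>..pi/\<tau>} \<sigma> \<partial>lborel)
       = (\<integral>\<^sup>+\<sigma>\<in>{-pi/\<tau>..pi/\<tau>}. f \<sigma> x \<partial>lborel) * indicator {-pi..pi} x" .
  qed
  finally show ?thesis .
qed

lemma measurable_time_poly:
  assumes [measurable]: "\<And>m. f m \<in> borel_measurable borel"
  shows "(\<lambda>(\<sigma>, x). time_poly \<tau> N (\<lambda>m. f m x) \<sigma>) \<in> borel_measurable (lborel \<Otimes>\<^sub>M lborel)"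
  unfolding time_poly_def by measurable

lemma has_integral_time_poly:
  assumes "0 < \<tau>"
  shows "((\<lambda>\<sigma>. (norm (time_poly \<tau> N c \<sigma>))\<^sup>2) has_integral (2 * pi * \<tau> * (\<Sum>m=-int N..int N. (norm (c m))\<^sup>2))) {-pi/\<tau>..pi/\<tau>}"
proof -
  have "((\<lambda>x. (norm (\<Sum>m=-int N..int N. c m * cis (of_int m * x)))\<^sup>2) has_integral
     (2 * pi * (\<Sum>m=-int N..int N. (norm (c m))\<^sup>2))) (cbox (-pi) pi)"
    using has_integral_norm_sum_cis[of "{-int N..int N}" c] by simp
  from has_integral_affinity[OF this, of \<tau> 0] assms
  have "((\<lambda>\<sigma>. (norm (\<Sum>m=-int N..int N. c m * cis (of_int m * (\<tau> * \<sigma>))))\<^sup>2) has_integral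
     (2 * pi * (\<Sum>m=-int N..int N. (norm (c m))\<^sup>2)) / \<tau>) ((\<lambda>x. x / \<tau>) ` {-pi..pi})"
    by (simp add: divide_inverse_commute)
  moreover have "(\<lambda>x. x / \<tau>) ` {-pi..pi} = {-pi/\<tau>..pi/\<tau>}"
    using assms image_divide_atLeastAtMost[of \<tau> "-pi" pi] by simp
  ultimately have "((\<lambda>\<sigma>. \<tau>\<^sup>2 * (norm (\<Sum>m=-int N..int N. c m * cis (of_int m * (\<tau> * \<sigma>))))\<^sup>2) has_integral
     \<tau>\<^sup>2 * ((2 * pi * (\<Sum>m=-int N..int N. (norm (c m))\<^sup>2)) / \<tau>)) {-pi/\<tau>..pi/\<tau>}"
    by (intro has_integral_mult_right) simp
  then show ?thesis
    using assms by (simp add: time_poly_def norm_mult power_mult_distrib power2_eq_square mult_ac)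
qed

lemma box_int_time_poly:
  assumes tau: "0 < \<tau>" and f: "\<And>m. f m \<in> borel_measurable borel"
  shows "box_int \<tau> (\<lambda>\<sigma> x. ennreal ((norm (time_poly \<tau> N (\<lambda>m. f m x) \<sigma>))\<^sup>2))
    = ennreal (2 * pi * \<tau>) * (\<Sum>m=-int N..int N. L2sq (f m))"
proof -
  note [measurable] = f measurable_time_poly[OF f]
  have "box_int \<tau> (\<lambda>\<sigma> x. ennreal ((norm (time_poly \<tau> N (\<lambda>m. f m x) \<sigma>))\<^sup>2))
    = (\<integral>\<^sup>+x\<in>{-pi..pi}. (\<integral>\<^sup>+\<sigma>\<in>{-pi/\<tau>..pi/\<tau>}. ennreal ((norm (time_poly \<tau> N (\<lambda>m. f m x) \<sigma>))\<^sup>2) \<partial>lborel) \<partial>lborel)"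
    by (rule box_int_swap) measurable
  also have "\<dots> = (\<integral>\<^sup>+x\<in>{-pi..pi}. ennreal (2 * pi * \<tau> * (\<Sum>m=-int N..int N. (norm (f m x))\<^sup>2)) \<partial>lborel)"
  proof (rule arg_cong[where f = "integral\<^sup>N lborel"], rule ext)
    fix x
    have "continuous_on {-pi/\<tau>..pi/\<tau>} (\<lambda>\<sigma>. (norm (time_poly \<tau> N (\<lambda>m. f m x) \<sigma>))\<^sup>2)"
      by (intro continuous_intros)
    from set_nn_integral_continuous[OF this]
    show "(\<integral>\<^sup>+\<sigma>\<in>{-pi/\<tau>..pi/\<tau>}. ennreal ((norm (time_poly \<tau> N (\<lambda>m. f m x) \<sigma>))\<^sup>2) \<partial>lborel) * indicator {-pi..pi} x
      = ennreal (2 * pi * \<tau> * (\<Sum>m=-int N..int N. (norm (f m x))\<^sup>2)) * indicator {-pi..pi} x"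
      unfolding integral_unique[OF has_integral_time_poly[OF tau]] by simp
  qed
  also have "\<dots> = (\<integral>\<^sup>+x. ennreal (2 * pi * \<tau>) * (\<Sum>m=-int N..int N. ennreal ((norm (f m x))\<^sup>2) * indicator {-pi..pi} x) \<partial>lborel)"
    using tau by (intro nn_integral_cong)
      (simp add: ennreal_mult sum_nonneg sum_ennreal[symmetric] sum_distrib_right mult.assoc del: sum_ennreal)
  also have "\<dots> = ennreal (2 * pi * \<tau>) * (\<integral>\<^sup>+x. (\<Sum>m=-int N..int N. ennreal ((norm (f m x))\<^sup>2) * indicator {-pi..pi} x) \<partial>lborel)"
    by (rule nn_integral_cmult) measurable
  also have "(\<integral>\<^sup>+x. (\<Sum>m=-int N..int N. ennreal ((norm (f m x))\<^sup>2) * indicator {-pi..pi} x) \<partial>lborel)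
     = (\<Sum>m=-int N..int N. \<integral>\<^sup>+x. ennreal ((norm (f m x))\<^sup>2) * indicator {-pi..pi} x \<partial>lborel)"
    by (rule nn_integral_sum) measurable
  finally show ?thesis unfolding L2sq_def .
qed

lemma norm_add3_squared_le:
  fixes a b c :: "'a::real_normed_vector"
  shows "(norm (a + b + c))\<^sup>2 \<le> 3 * ((norm a)\<^sup>2 + (norm b)\<^sup>2 + (norm c)\<^sup>2)"
proof -
  have "norm (a + b + c) \<le> norm a + norm b + norm c"
    by (meson add_right_mono norm_triangle_ineq order_trans)
  then have "(norm (a + b + c))\<^sup>2 \<le> (norm a + norm b + norm c)\<^sup>2" by (intro power_mono) auto
  also have "\<dots> \<le> 3 * ((norm a)\<^sup>2 + (norm b)\<^sup>2 + (norm c)\<^sup>2)"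
    using sum_squares_bound[of "norm a" "norm b"] sum_squares_bound[of "norm a" "norm c"]
      sum_squares_bound[of "norm b" "norm c"]
    by (simp add: power2_eq_square algebra_simps)
  finally show ?thesis .
qed

lemma has_time_fourierD:
  assumes "has_time_fourier \<tau> u F"
  shows "\<And>m. u m \<in> borel_measurable borel" "\<And>m. L2sq (u m) < top"
    "case_prod F \<in> borel_measurable (lborel \<Otimes>\<^sub>M lborel)"
    "(\<lambda>N. box_int \<tau> (\<lambda>\<sigma> x. ennreal ((norm (F \<sigma> x - time_poly \<tau> N (\<lambda>m. u m x) \<sigma>))\<^sup>2))) \<longlonglongrightarrow> 0"
proof -
  show "u m \<in> borel_measurable borel" "L2sq (u m) < top" for m
    using assms torus_L2D by (auto simp: has_time_fourier_def)
  show "case_prod F \<in> borel_measurable (lborel \<Otimes>\<^sub>M lborel)"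
    using assms by (simp add: has_time_fourier_def)
  have "of_real \<tau> * (\<Sum>m=-int N..int N. u m x * exp (\<i> * of_int m * of_real \<tau> * of_real \<sigma>))
     = time_poly \<tau> N (\<lambda>m. u m x) \<sigma>" for N \<sigma> x
    by (simp add: time_poly_def cis_conv_exp mult.assoc)
  then show "(\<lambda>N. box_int \<tau> (\<lambda>\<sigma> x. ennreal ((norm (F \<sigma> x - time_poly \<tau> N (\<lambda>m. u m x) \<sigma>))\<^sup>2))) \<longlonglongrightarrow> 0"
    using assms by (simp add: has_time_fourier_def box_int_def)
qed

text \<open>For fixed \<open>\<sigma>\<close>, the numbers \<open>time_poly \<tau> N (\<lambda>m. fourier_coeff (v m) k) \<sigma>\<close> are the Fourier coefficients in \<open>x\<close>
of \<open>time_poly \<tau> N (\<lambda>m. v m x) \<sigma>\<close>, so this is Bessel's inequality integrated in \<open>\<sigma>\<close>.\<close>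

lemma weighted_energy_le_box_int:
  assumes J: "finite J"
    and v: "\<And>m. v m \<in> borel_measurable borel" "\<And>m. L2sq (v m) < top"
    and M: "continuous_on UNIV M" "\<And>\<sigma>. 0 \<le> M \<sigma>"
  shows "ennreal (2 * pi * (\<Sum>k\<in>J. integral {-pi/\<tau>..pi/\<tau>}
        (\<lambda>\<sigma>. M \<sigma> * (norm (time_poly \<tau> N (\<lambda>m. fourier_coeff (v m) k) \<sigma>))\<^sup>2)))
    \<le> box_int \<tau> (\<lambda>\<sigma> x. ennreal (M \<sigma> * (norm (time_poly \<tau> N (\<lambda>m. v m x) \<sigma>))\<^sup>2))"
proof -
  define g where "g k \<sigma> = M \<sigma> * (norm (time_poly \<tau> N (\<lambda>m. fourier_coeff (v m) k) \<sigma>))\<^sup>2" for k \<sigma>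
  have contM: "continuous_on A M" for A by (rule continuous_on_subset[OF M(1)]) simp
  have contg: "continuous_on A (g k)" for A k
    unfolding g_def by (intro continuous_intros contM)
  have "2 * pi * (\<Sum>k\<in>J. integral {-pi/\<tau>..pi/\<tau>} (g k)) = integral {-pi/\<tau>..pi/\<tau>} (\<lambda>\<sigma>. 2 * pi * (\<Sum>k\<in>J. g k \<sigma>))"
    by (simp add: Henstock_Kurzweil_Integration.integral_sum[OF J integrable_continuous_real[OF contg]])
  then have "ennreal (2 * pi * (\<Sum>k\<in>J. integral {-pi/\<tau>..pi/\<tau>} (g k)))
     = (\<integral>\<^sup>+\<sigma>\<in>{-pi/\<tau>..pi/\<tau>}. ennreal (2 * pi * (\<Sum>k\<in>J. g k \<sigma>)) \<partial>lborel)"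
  proof -
    have "continuous_on {-pi/\<tau>..pi/\<tau>} (\<lambda>\<sigma>. 2 * pi * (\<Sum>k\<in>J. g k \<sigma>))"
      by (intro continuous_on_mult continuous_on_const continuous_on_sum contg)
    moreover have "0 \<le> 2 * pi * (\<Sum>k\<in>J. g k \<sigma>)" for \<sigma>
      by (intro mult_nonneg_nonneg sum_nonneg) (auto simp: g_def M(2))
    ultimately show ?thesis
      using \<open>2 * pi * _ = integral _ _\<close> by (simp only: set_nn_integral_continuous)
  qed
  also have "\<dots> \<le> box_int \<tau> (\<lambda>\<sigma> x. ennreal (M \<sigma> * (norm (time_poly \<tau> N (\<lambda>m. v m x) \<sigma>))\<^sup>2))"
    unfolding box_int_def
  proof (intro nn_integral_mono mult_right_mono)
    fix \<sigma>
    note [measurable] = v(1)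
    have meas: "(\<lambda>x. time_poly \<tau> N (\<lambda>m. v m x) \<sigma>) \<in> borel_measurable borel"
      unfolding time_poly_def by measurable
    have "2 * pi * (\<Sum>k\<in>J. g k \<sigma>)
       = M \<sigma> * (2 * pi * (\<Sum>k\<in>J. (norm (fourier_coeff (\<lambda>x. time_poly \<tau> N (\<lambda>m. v m x) \<sigma>) k))\<^sup>2))"
      by (simp add: g_def fourier_coeff_time_poly[OF v] sum_distrib_left mult_ac)
    then have "ennreal (2 * pi * (\<Sum>k\<in>J. g k \<sigma>))
       = ennreal (M \<sigma>) * ennreal (2 * pi * (\<Sum>k\<in>J. (norm (fourier_coeff (\<lambda>x. time_poly \<tau> N (\<lambda>m. v m x) \<sigma>) k))\<^sup>2))"
      by (simp only:) (rule ennreal_mult, use M(2) in \<open>auto intro!: mult_nonneg_nonneg sum_nonneg\<close>)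
    also have "\<dots> \<le> ennreal (M \<sigma>) * L2sq (\<lambda>x. time_poly \<tau> N (\<lambda>m. v m x) \<sigma>)"
      by (intro mult_left_mono bessel meas J) simp
    also have "\<dots> = (\<integral>\<^sup>+x. ennreal (M \<sigma>) * (ennreal ((norm (time_poly \<tau> N (\<lambda>m. v m x) \<sigma>))\<^sup>2) * indicator {-pi..pi} x) \<partial>lborel)"
      unfolding L2sq_def by (rule nn_integral_cmult[symmetric]) (use meas in measurable)
    also have "\<dots> = (\<integral>\<^sup>+x\<in>{-pi..pi}. ennreal (M \<sigma> * (norm (time_poly \<tau> N (\<lambda>m. v m x) \<sigma>))\<^sup>2) \<partial>lborel)"
      using M(2) by (simp add: ennreal_mult mult.assoc)
    finally show "ennreal (2 * pi * (\<Sum>k\<in>J. g k \<sigma>))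
       \<le> (\<integral>\<^sup>+x\<in>{-pi..pi}. ennreal (M \<sigma> * (norm (time_poly \<tau> N (\<lambda>m. v m x) \<sigma>))\<^sup>2) \<partial>lborel)" .
  qed simp
  finally show ?thesis by (simp only: g_def[abs_def])
qed

text \<open>Write \<open>P\<^sub>N v\<close> and \<open>P\<^sub>N w\<close> for the truncated transforms.  Then
\<open>M P\<^sub>N v = M (P\<^sub>N v - F) + (M F - P\<^sub>N w) + P\<^sub>N w\<close>.  The first two terms tend to zero in the limit, the first one because
\<open>M\<close> is bounded; the last one is computed by orthogonality in time.\<close>

lemma box_int_multiplier_le:
  fixes M :: "real \<Rightarrow> real"
  assumes tau: "0 < \<tau>" and v: "has_time_fourier \<tau> v F"
    and w: "has_time_fourier \<tau> w (\<lambda>\<sigma> x. of_real (M \<sigma>) * F \<sigma> x)"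
    and B: "\<And>\<sigma>. (M \<sigma>)\<^sup>2 \<le> B"
  shows "box_int \<tau> (\<lambda>\<sigma> x. ennreal ((M \<sigma>)\<^sup>2 * (norm (time_poly \<tau> N (\<lambda>m. v m x) \<sigma>))\<^sup>2))
   \<le> 3 * (ennreal B * box_int \<tau> (\<lambda>\<sigma> x. ennreal ((norm (F \<sigma> x - time_poly \<tau> N (\<lambda>m. v m x) \<sigma>))\<^sup>2))
      + box_int \<tau> (\<lambda>\<sigma> x. ennreal ((norm (of_real (M \<sigma>) * F \<sigma> x - time_poly \<tau> N (\<lambda>m. w m x) \<sigma>))\<^sup>2))
      + ennreal (2 * pi * \<tau>) * (\<Sum>m=-int N..int N. L2sq (w m)))"
proof -
  note meas = measurable_time_poly[OF has_time_fourierD(1)[OF v], of \<tau> N]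
    measurable_time_poly[OF has_time_fourierD(1)[OF w], of \<tau> N]
    has_time_fourierD(3)[OF v] has_time_fourierD(3)[OF w]
  have B0: "0 \<le> B" using B[of 0] zero_le_power2 order_trans by blast
  define e1 where "e1 = (\<lambda>\<sigma> x. ennreal ((norm (F \<sigma> x - time_poly \<tau> N (\<lambda>m. v m x) \<sigma>))\<^sup>2))"
  define e2 where "e2 = (\<lambda>\<sigma> x. ennreal ((norm (of_real (M \<sigma>) * F \<sigma> x - time_poly \<tau> N (\<lambda>m. w m x) \<sigma>))\<^sup>2))"
  define e3 where "e3 = (\<lambda>\<sigma> x. ennreal ((norm (time_poly \<tau> N (\<lambda>m. w m x) \<sigma>))\<^sup>2))"
  have [measurable]: "case_prod e1 \<in> borel_measurable (lborel \<Otimes>\<^sub>M lborel)"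
    "case_prod e2 \<in> borel_measurable (lborel \<Otimes>\<^sub>M lborel)"
    "case_prod e3 \<in> borel_measurable (lborel \<Otimes>\<^sub>M lborel)"
    using meas unfolding e1_def e2_def e3_def case_prod_unfold
    by (auto intro!: measurable_compose[OF _ measurable_ennreal] borel_measurable_power
      borel_measurable_norm borel_measurable_diff)
  have "ennreal ((M \<sigma>)\<^sup>2 * (norm (time_poly \<tau> N (\<lambda>m. v m x) \<sigma>))\<^sup>2)
     \<le> 3 * (ennreal B * e1 \<sigma> x + e2 \<sigma> x + e3 \<sigma> x)" for \<sigma> x
  proof -
    define a where "a = of_real (M \<sigma>) * (time_poly \<tau> N (\<lambda>m. v m x) \<sigma> - F \<sigma> x)"
    define b where "b = of_real (M \<sigma>) * F \<sigma> x - time_poly \<tau> N (\<lambda>m. w m x) \<sigma>"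
    define c where "c = time_poly \<tau> N (\<lambda>m. w m x) \<sigma>"
    have "(M \<sigma>)\<^sup>2 * (norm (time_poly \<tau> N (\<lambda>m. v m x) \<sigma>))\<^sup>2 = (norm (a + b + c))\<^sup>2"
      by (simp add: a_def b_def c_def right_diff_distrib norm_mult power_mult_distrib)
    also have "\<dots> \<le> 3 * ((norm a)\<^sup>2 + (norm b)\<^sup>2 + (norm c)\<^sup>2)" by (rule norm_add3_squared_le)
    also have "(norm a)\<^sup>2 \<le> B * (norm (F \<sigma> x - time_poly \<tau> N (\<lambda>m. v m x) \<sigma>))\<^sup>2"
      unfolding a_def norm_mult power_mult_distrib norm_minus_commute[of "F \<sigma> x"]
      by (intro mult_right_mono) (use B in auto)
    finally have "ennreal ((M \<sigma>)\<^sup>2 * (norm (time_poly \<tau> N (\<lambda>m. v m x) \<sigma>))\<^sup>2)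
      \<le> ennreal (3 * (B * (norm (F \<sigma> x - time_poly \<tau> N (\<lambda>m. v m x) \<sigma>))\<^sup>2 + (norm b)\<^sup>2 + (norm c)\<^sup>2))"
      by (intro ennreal_leI) simp
    also have "\<dots> = 3 * (ennreal B * e1 \<sigma> x + e2 \<sigma> x + e3 \<sigma> x)"
      using B0 by (simp add: ennreal_mult e1_def e2_def e3_def b_def c_def)
    finally show ?thesis .
  qed
  then have "box_int \<tau> (\<lambda>\<sigma> x. ennreal ((M \<sigma>)\<^sup>2 * (norm (time_poly \<tau> N (\<lambda>m. v m x) \<sigma>))\<^sup>2))
     \<le> box_int \<tau> (\<lambda>\<sigma> x. 3 * (ennreal B * e1 \<sigma> x + e2 \<sigma> x + e3 \<sigma> x))"
    by (rule box_int_mono)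
  also have "\<dots> = 3 * box_int \<tau> (\<lambda>\<sigma> x. ennreal B * e1 \<sigma> x + e2 \<sigma> x + e3 \<sigma> x)"
    by (rule box_int_cmult) measurable
  also have "box_int \<tau> (\<lambda>\<sigma> x. ennreal B * e1 \<sigma> x + e2 \<sigma> x + e3 \<sigma> x)
     = box_int \<tau> (\<lambda>\<sigma> x. ennreal B * e1 \<sigma> x + e2 \<sigma> x) + box_int \<tau> e3"
    by (rule box_int_add) measurable
  also have "box_int \<tau> (\<lambda>\<sigma> x. ennreal B * e1 \<sigma> x + e2 \<sigma> x) = box_int \<tau> (\<lambda>\<sigma> x. ennreal B * e1 \<sigma> x) + box_int \<tau> e2"
    by (rule box_int_add) measurable
  also have "box_int \<tau> (\<lambda>\<sigma> x. ennreal B * e1 \<sigma> x) = ennreal B * box_int \<tau> e1"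
    by (rule box_int_cmult) measurable
  also have "box_int \<tau> e3 = ennreal (2 * pi * \<tau>) * (\<Sum>m=-int N..int N. L2sq (w m))"
    unfolding e3_def by (rule box_int_time_poly[OF tau has_time_fourierD(1)[OF w]])
  finally show ?thesis by (simp only: e1_def e2_def)
qed

section \<open>Passage to the limit\<close>

text \<open>The symbol \<open>M = \<langle>d\<rangle>\<^bsup>3/8\<^esup>\<close> has \<open>M\<^sup>2 \<le> \<langle>d\<rangle> \<le> 3 / \<tau>\<close>.  This bound depends on \<open>\<tau>\<close>, but it only
multiplies the error term \<open>e N\<close>, which tends to zero; the main term carries the absolute constant \<open>3\<close>.\<close>

lemma eventually_energy_le:
  fixes \<tau> s \<epsilon> :: real
  assumes tau: "0 < \<tau>" "\<tau> \<le> 1" and J: "finite J" and eps: "0 < \<epsilon>"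
    and mult: "time_multiplier \<tau> (\<lambda>\<sigma>. of_real (japanese (d_sym \<tau> \<sigma>) powr (3/8))) v w"
    and s: "ennreal \<tau> * (\<Sum>\<^sub>\<infinity>n. L2sq (w n)) = ennreal s" "0 \<le> s"
  shows "\<forall>\<^sub>F N in sequentially. (\<Sum>k\<in>J. integral {-pi/\<tau>..pi/\<tau>}
      (\<lambda>\<sigma>. japanese (d_sym \<tau> \<sigma>) powr (3/4) * (norm (time_poly \<tau> N (\<lambda>m. fourier_coeff (v m) k) \<sigma>))\<^sup>2)) \<le> 3 * s + \<epsilon>"
proof -
  define M where "M \<sigma> = japanese (d_sym \<tau> \<sigma>) powr (3/8)" for \<sigma>
  obtain F where v: "has_time_fourier \<tau> v F" and w: "has_time_fourier \<tau> w (\<lambda>\<sigma> x. of_real (M \<sigma>) * F \<sigma> x)"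
    using mult by (auto simp: time_multiplier_def M_def)
  have Msq: "(M \<sigma>)\<^sup>2 = japanese (d_sym \<tau> \<sigma>) powr (3/4)" for \<sigma>
    by (simp add: M_def power2_eq_square powr_add[symmetric])
  have MB: "(M \<sigma>)\<^sup>2 \<le> 3 / \<tau>" for \<sigma>
  proof -
    have "(M \<sigma>)\<^sup>2 \<le> japanese (d_sym \<tau> \<sigma>) powr 1"
      unfolding Msq by (intro powr_mono one_le_japanese) auto
    also have "\<dots> = japanese (d_sym \<tau> \<sigma>)" using one_le_japanese[of "d_sym \<tau> \<sigma>"] by simp
    also have "\<dots> \<le> 3 / \<tau>" by (rule japanese_d_sym_le[OF tau])
    finally show ?thesis .
  qed
  have contM: "continuous_on UNIV M" unfolding M_def by (intro continuous_intros)
  define e where "e N = 3 * (ennreal (3 / \<tau>) * box_int \<tau> (\<lambda>\<sigma> x. ennreal ((norm (F \<sigma> x - time_poly \<tau> N (\<lambda>m. v m x) \<sigma>))\<^sup>2))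
      + box_int \<tau> (\<lambda>\<sigma> x. ennreal ((norm (of_real (M \<sigma>) * F \<sigma> x - time_poly \<tau> N (\<lambda>m. w m x) \<sigma>))\<^sup>2)))" for N
  have "e \<longlonglongrightarrow> 3 * (ennreal (3 / \<tau>) * 0 + 0)"
    unfolding e_def
    by (intro tendsto_add ennreal_tendsto_cmult has_time_fourierD(4)[OF v] has_time_fourierD(4)[OF w]) auto
  then have "e \<longlonglongrightarrow> 0" by simp
  then have "\<forall>\<^sub>F N in sequentially. e N < ennreal \<epsilon>"
    using eps by (intro order_tendstoD(2)) auto
  then show ?thesis
  proof (rule eventually_mono)
    fix N assume eN: "e N < ennreal \<epsilon>"
    define E where "E = (\<Sum>k\<in>J. integral {-pi/\<tau>..pi/\<tau>}
      (\<lambda>\<sigma>. (M \<sigma>)\<^sup>2 * (norm (time_poly \<tau> N (\<lambda>m. fourier_coeff (v m) k) \<sigma>))\<^sup>2))"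
    have "ennreal (2 * pi * E) \<le> box_int \<tau> (\<lambda>\<sigma> x. ennreal ((M \<sigma>)\<^sup>2 * (norm (time_poly \<tau> N (\<lambda>m. v m x) \<sigma>))\<^sup>2))"
      unfolding E_def
      by (rule weighted_energy_le_box_int[OF J has_time_fourierD(1,2)[OF v]])
        (auto intro!: continuous_intros contM)
    also have "\<dots> \<le> 3 * (ennreal (3 / \<tau>) * box_int \<tau> (\<lambda>\<sigma> x. ennreal ((norm (F \<sigma> x - time_poly \<tau> N (\<lambda>m. v m x) \<sigma>))\<^sup>2))
      + box_int \<tau> (\<lambda>\<sigma> x. ennreal ((norm (of_real (M \<sigma>) * F \<sigma> x - time_poly \<tau> N (\<lambda>m. w m x) \<sigma>))\<^sup>2))
      + ennreal (2 * pi * \<tau>) * (\<Sum>m=-int N..int N. L2sq (w m)))"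
      by (rule box_int_multiplier_le[OF tau(1) v w MB])
    also have "\<dots> = e N + 3 * (ennreal (2 * pi * \<tau>) * (\<Sum>m=-int N..int N. L2sq (w m)))"
      by (simp only: e_def distrib_left)
    also have "ennreal (2 * pi * \<tau>) * (\<Sum>m=-int N..int N. L2sq (w m)) \<le> ennreal (2 * pi * \<tau>) * (\<Sum>\<^sub>\<infinity>n. L2sq (w n))"
      by (intro mult_left_mono) (auto simp: nonneg_infsum_complete intro: SUP_upper)
    also have "\<dots> = ennreal (2 * pi * s)"
      using tau s by (simp add: ennreal_mult mult.assoc)
    finally have "ennreal (2 * pi * E) \<le> e N + 3 * ennreal (2 * pi * s)"
      by (simp add: add_left_mono mult_left_mono)
    also have "\<dots> \<le> ennreal \<epsilon> + 3 * ennreal (2 * pi * s)"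
      using eN by (intro add_right_mono) simp
    also have "\<dots> = ennreal (\<epsilon> + 3 * (2 * pi * s))"
    proof -
      have "ennreal (3 * (2 * pi * s)) = ennreal 3 * ennreal (2 * pi * s)"
        using s(2) by (intro ennreal_mult) auto
      moreover have "ennreal (\<epsilon> + 3 * (2 * pi * s)) = ennreal \<epsilon> + ennreal (3 * (2 * pi * s))"
        using eps s(2) by (intro ennreal_plus) auto
      ultimately show ?thesis by (simp only: ennreal_numeral)
    qed
    finally have "2 * pi * E \<le> \<epsilon> + 3 * (2 * pi * s)"
      using eps s(2) by (subst (asm) ennreal_le_iff) auto
    also have "\<epsilon> \<le> 2 * pi * \<epsilon>" using eps pi_gt3 by simp
    finally have "2 * pi * E \<le> 2 * pi * (3 * s + \<epsilon>)" by (simp add: algebra_simps)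
    then have "E \<le> 3 * s + \<epsilon>" by simp
    then show "(\<Sum>k\<in>J. integral {-pi/\<tau>..pi/\<tau>}
      (\<lambda>\<sigma>. japanese (d_sym \<tau> \<sigma>) powr (3/4) * (norm (time_poly \<tau> N (\<lambda>m. fourier_coeff (v m) k) \<sigma>))\<^sup>2)) \<le> 3 * s + \<epsilon>"
      by (simp only: E_def Msq)
  qed
qed

lemma cutoff_bounded:
  assumes "cutoff chi"
  shows "\<exists>B\<ge>1. \<forall>x. chi x \<le> B"
proof -
  have "chi differentiable_on UNIV" using assms unfolding cutoff_def by (metis funpow_0)
  then have "continuous_on {-2..2} chi"
    using differentiable_imp_continuous_on continuous_on_subset by blast
  then obtain x0 where x0: "\<And>x. x \<in> {-2..2} \<Longrightarrow> chi x \<le> chi x0"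
    using continuous_attains_sup[of "{-2..2::real}" chi] by fastforce
  have "chi x \<le> max 1 (chi x0)" for x
    using x0[of x] assms by (cases "x \<in> {-2..2}") (auto simp: cutoff_def)
  then show ?thesis by (intro exI[of _ "max 1 (chi x0)"]) auto
qed

lemma freq_filter_eq_sum:
  assumes "cutoff chi" "0 < K"
  shows "freq_filter chi K f x
    = (\<Sum>k\<in>freqs K. of_real ((chi (of_int k / K))\<^sup>2) * fourier_coeff f k * cis (of_int k * x))"
proof -
  have zero: "chi (of_int k / K) = 0" if "k \<notin> freqs K" for k
  proof -
    have "of_int k / K \<notin> {-2..2}"
      using that assms(2) by (auto simp: freqs_def abs_le_iff field_simps)
    then show ?thesis using assms(1) by (auto simp: cutoff_def)
  qed
  have "freq_filter chi K f x = (\<Sum>\<^sub>\<infinity>k\<in>freqs K. of_real ((chi (of_int k / K))\<^sup>2) * fourier_coeff f k * exp (\<i> * of_int k * of_real x))"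
    unfolding freq_filter_def by (rule infsum_cong_neutral) (auto simp: zero)
  then show ?thesis by (simp add: cis_conv_exp mult.assoc)
qed

lemma time_poly_cmult: "time_poly \<tau> N (\<lambda>m. a * c m) \<sigma> = a * time_poly \<tau> N c \<sigma>"
  by (simp add: time_poly_def sum_distrib_left mult_ac)

text \<open>Undoing the twist by \<open>exp(i n \<tau> k\<^sup>2)\<close> brings the filtered functions into the form of \<open>truncated_strichartz\<close>, with
the squared cutoff absorbed in \<open>V\<close>.  That estimate at a large truncation parameter \<open>N\<close> also bounds the
sum over \<open>\<bar>n\<bar> \<le> N0\<close>; this is used with energy at most \<open>3 s + \<epsilon>\<close>, and then \<open>\<epsilon>\<close> tends to zero.\<close>

lemma sum_integral_filter_le:
  fixes \<tau> K s B :: real and u v w :: "int \<Rightarrow> real \<Rightarrow> complex"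
  assumes chi: "cutoff chi" and B: "\<And>x. chi x \<le> B"
    and tau: "0 < \<tau>" "\<tau> \<le> 1" and K: "0 < K" "1 \<le> K\<^sup>2 * \<tau>"
    and coeff: "\<And>n k. fourier_coeff (v n) k = cis (of_int n * \<tau> * (of_int k)\<^sup>2) * fourier_coeff (u n) k"
    and mult: "time_multiplier \<tau> (\<lambda>\<sigma>. of_real (japanese (d_sym \<tau> \<sigma>) powr (3/8))) v w"
    and s: "ennreal \<tau> * (\<Sum>\<^sub>\<infinity>n. L2sq (w n)) = ennreal s" "0 \<le> s"
  shows "(\<Sum>n=-int N0..int N0. integral {-pi..pi} (\<lambda>x. norm (freq_filter chi K (u n) x) ^ 4))
    \<le> strichartz_const * K\<^sup>2 * (B ^ 4 * (3 * s))\<^sup>2"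
proof -
  define V where "V n k = of_real ((chi (of_int k / K))\<^sup>2) * fourier_coeff (v n) k" for n k
  have chi0: "0 \<le> chi x" for x using chi by (simp add: cutoff_def)
  have B0: "0 \<le> B" using chi0[of 0] B[of 0] by linarith
  have filt: "freq_filter chi K (u n) x
      = (\<Sum>k\<in>freqs K. V n k * cis (- (of_int n * \<tau> * (of_int k)\<^sup>2)) * cis (of_int k * x))" for n x
  proof -
    have "fourier_coeff (v n) k * cis (- (of_int n * \<tau> * (of_int k)\<^sup>2)) = fourier_coeff (u n) k" for k
    proof -
      have "fourier_coeff (v n) k * cis (- (of_int n * \<tau> * (of_int k)\<^sup>2))
        = (cis (of_int n * \<tau> * (of_int k)\<^sup>2) * cis (- (of_int n * \<tau> * (of_int k)\<^sup>2))) * fourier_coeff (u n) k"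
        unfolding coeff by (simp only: mult_ac)
      then show ?thesis by (simp only: cis_mult) simp
    qed
    then show ?thesis
      unfolding freq_filter_eq_sum[OF chi K(1)] V_def by (simp only: mult.assoc)
  qed
  define E where "E N = (\<Sum>k\<in>freqs K. integral {-pi/\<tau>..pi/\<tau>}
      (\<lambda>\<sigma>. japanese (d_sym \<tau> \<sigma>) powr (3/4) * (norm (time_poly \<tau> N (\<lambda>m. fourier_coeff (v m) k) \<sigma>))\<^sup>2))" for N
  define E' where "E' N = (\<Sum>k\<in>freqs K. integral {-pi/\<tau>..pi/\<tau>}
      (\<lambda>\<sigma>. japanese (d_sym \<tau> \<sigma>) powr (3/4) * (norm (time_poly \<tau> N (\<lambda>m. V m k) \<sigma>))\<^sup>2))" for N
  have E'0: "0 \<le> E' N" for N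
    unfolding E'_def by (intro sum_nonneg integral_nonneg integrable_continuous_real continuous_intros) auto
  have E'E: "E' N \<le> B ^ 4 * E N" for N
    unfolding E'_def E_def sum_distrib_left
  proof (intro sum_mono)
    fix k
    define I where "I = integral {-pi/\<tau>..pi/\<tau>}
      (\<lambda>\<sigma>. japanese (d_sym \<tau> \<sigma>) powr (3/4) * (norm (time_poly \<tau> N (\<lambda>m. fourier_coeff (v m) k) \<sigma>))\<^sup>2)"
    have "japanese (d_sym \<tau> \<sigma>) powr (3/4) * (norm (time_poly \<tau> N (\<lambda>m. V m k) \<sigma>))\<^sup>2
      = (chi (of_int k / K)) ^ 4 * (japanese (d_sym \<tau> \<sigma>) powr (3/4) * (norm (time_poly \<tau> N (\<lambda>m. fourier_coeff (v m) k) \<sigma>))\<^sup>2)" for \<sigma>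
      unfolding V_def time_poly_cmult norm_mult power_mult_distrib norm_of_real
      by (simp add: power_mult[symmetric])
    then have "integral {-pi/\<tau>..pi/\<tau>} (\<lambda>\<sigma>. japanese (d_sym \<tau> \<sigma>) powr (3/4) * (norm (time_poly \<tau> N (\<lambda>m. V m k) \<sigma>))\<^sup>2)
       = (chi (of_int k / K)) ^ 4 * I"
      by (simp only: I_def integral_mult_right)
    also have "\<dots> \<le> B ^ 4 * I"
      unfolding I_def
      by (intro mult_right_mono power_mono B chi0 integral_nonneg integrable_continuous_real continuous_intros) auto
    finally show "integral {-pi/\<tau>..pi/\<tau>} (\<lambda>\<sigma>. japanese (d_sym \<tau> \<sigma>) powr (3/4) * (norm (time_poly \<tau> N (\<lambda>m. V m k) \<sigma>))\<^sup>2)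
      \<le> B ^ 4 * integral {-pi/\<tau>..pi/\<tau>}
      (\<lambda>\<sigma>. japanese (d_sym \<tau> \<sigma>) powr (3/4) * (norm (time_poly \<tau> N (\<lambda>m. fourier_coeff (v m) k) \<sigma>))\<^sup>2)"
      by (simp only: I_def)
  qed
  define I where "I n = integral {-pi..pi} (\<lambda>x. norm (freq_filter chi K (u n) x) ^ 4)" for n
  have I0: "0 \<le> I n" for n
    unfolding I_def filt by (intro integral_nonneg integrable_continuous_real continuous_intros) auto
  have trunc: "(\<Sum>n=-int N..int N. I n) \<le> strichartz_const * K\<^sup>2 * (E' N)\<^sup>2" for N
    unfolding I_def filt E'_def by (rule truncated_strichartz[OF tau K(2)])
  have bound: "(\<Sum>n=-int N0..int N0. I n) \<le> strichartz_const * K\<^sup>2 * (B ^ 4 * (3 * s + \<epsilon>))\<^sup>2" if eps: "0 < \<epsilon>" for \<epsilon>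
  proof -
    have "\<forall>\<^sub>F N in sequentially. E N \<le> 3 * s + \<epsilon> \<and> N0 \<le> N"
      unfolding E_def
      by (intro eventually_conj eventually_energy_le[OF tau _ eps mult s] eventually_ge_at_top) simp
    then obtain N where N: "E N \<le> 3 * s + \<epsilon>" "N0 \<le> N"
      using eventually_happens trivial_limit_sequentially by blast
    have "(\<Sum>n=-int N0..int N0. I n) \<le> (\<Sum>n=-int N..int N. I n)"
      using N(2) I0 by (intro sum_mono2) auto
    also have "\<dots> \<le> strichartz_const * K\<^sup>2 * (E' N)\<^sup>2" by (rule trunc)
    also have "\<dots> \<le> strichartz_const * K\<^sup>2 * (B ^ 4 * (3 * s + \<epsilon>))\<^sup>2"
    proof (intro mult_left_mono power_mono E'0)
      have "B ^ 4 * E N \<le> B ^ 4 * (3 * s + \<epsilon>)" using N(1) B0 by (intro mult_left_mono) auto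
      with E'E[of N] show "E' N \<le> B ^ 4 * (3 * s + \<epsilon>)" by linarith
    qed (use strichartz_const_pos in simp)
    finally show ?thesis .
  qed
  have "(\<Sum>n=-int N0..int N0. I n) \<le> strichartz_const * K\<^sup>2 * (B ^ 4 * (3 * s + 0))\<^sup>2"
  proof (rule tendsto_lowerbound)
    show "((\<lambda>\<epsilon>. strichartz_const * K\<^sup>2 * (B ^ 4 * (3 * s + \<epsilon>))\<^sup>2) \<longlongrightarrow> strichartz_const * K\<^sup>2 * (B ^ 4 * (3 * s + 0))\<^sup>2) (at_right 0)"
      by (intro tendsto_intros)
    show "\<forall>\<^sub>F \<epsilon> in at_right 0. (\<Sum>n=-int N0..int N0. I n) \<le> strichartz_const * K\<^sup>2 * (B ^ 4 * (3 * s + \<epsilon>))\<^sup>2"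
      using bound by (auto simp: eventually_at_right_field intro!: exI[of _ 1])
  qed simp
  then show ?thesis by (simp add: I_def)
qed

lemma infsum_ennreal_le_of_symmetric_sums:
  fixes r :: "int \<Rightarrow> real"
  assumes "\<And>n. 0 \<le> r n" and "\<And>N::nat. (\<Sum>n=-int N..int N. r n) \<le> c"
  shows "(\<Sum>\<^sub>\<infinity>n. ennreal (r n)) \<le> ennreal c"
proof (rule infsum_le_finite_sums)
  show "(\<lambda>n. ennreal (r n)) summable_on UNIV" by (rule nonneg_summable_on_complete) simp
  fix F :: "int set" assume F: "finite F"
  define N where "N = nat (Max (insert 0 (abs ` F)))"
  have "\<bar>n\<bar> \<le> Max (insert 0 (abs ` F))" if "n \<in> F" for n
    using F that by (intro Max_ge) auto
  then have "F \<subseteq> {- int N..int N}" by (force simp: N_def)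
  then have "(\<Sum>n\<in>F. r n) \<le> (\<Sum>n=-int N..int N. r n)"
    using assms(1) by (intro sum_mono2) auto
  also have "\<dots> \<le> c" by (rule assms(2))
  finally show "(\<Sum>n\<in>F. ennreal (r n)) \<le> ennreal c"
    using assms(1) by (simp add: ennreal_leI)
qed

theorem lemma3p6:
  fixes chi :: "real \<Rightarrow> real"
  assumes "cutoff chi"
  shows "\<exists>C::real. C > 0 \<and>
    (\<forall>(\<tau>::real) (K::real) (u :: int \<Rightarrow> real \<Rightarrow> complex).
       0 < \<tau> \<and> \<tau> \<le> 1 \<and> K \<ge> \<tau> powr (- 1/2) \<and>
       (\<forall>n. torus_fun (u n)) \<and> bourgain_norm \<tau> 0 (3/8) u < top \<longrightarrow>
       lp_norm \<tau> 4 (\<lambda>n. Lp_norm 4 (freq_filter chi K (u n)))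
         \<le> ennreal (C * (K * \<tau> powr (1/2)) powr (1/2)) * bourgain_norm \<tau> 0 (3/8) u)"
proof -
  obtain B where B: "1 \<le> B" "\<And>x. chi x \<le> B" using cutoff_bounded[OF assms] by blast
  define C where "C = (9 * strichartz_const * B ^ 8) powr (1/4)"
  have C: "0 < C" using B(1) strichartz_const_pos by (simp add: C_def)
  show ?thesis
  proof (intro exI[of _ C] conjI C allI impI)
    fix \<tau> K :: real and u :: "int \<Rightarrow> real \<Rightarrow> complex"
    assume "0 < \<tau> \<and> \<tau> \<le> 1 \<and> K \<ge> \<tau> powr (- 1/2) \<and>
       (\<forall>n. torus_fun (u n)) \<and> bourgain_norm \<tau> 0 (3/8) u < top"
    then have tau: "0 < \<tau>" "\<tau> \<le> 1" and K: "\<tau> powr (- 1/2) \<le> K" and fin: "bourgain_norm \<tau> 0 (3/8) u < top"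
      by auto
    have K0: "0 < K" using K tau by (smt (verit) powr_gt_zero)
    \<comment> \<open>In this form the hypothesis absorbs the constant and the term \<open>2\<^sup>j \<tau>\<close> in the count of lattice points.\<close>
    have K1: "1 \<le> K\<^sup>2 * \<tau>"
    proof -
      have "(\<tau> powr (- 1/2))\<^sup>2 = 1 / \<tau>"
        using tau by (simp add: power2_eq_square powr_add[symmetric] powr_minus_divide)
      moreover have "(\<tau> powr (- 1/2))\<^sup>2 \<le> K\<^sup>2" using K by (intro power_mono) auto
      ultimately have "1 / \<tau> \<le> K\<^sup>2" by linarith
      then show ?thesis using tau by (simp add: field_simps)
    qed
    define w where "w = (SOME w. bourgain_image \<tau> 0 (3/8) u w)"
    have ex: "\<exists>w. bourgain_image \<tau> 0 (3/8) u w" using fin by (auto simp: bourgain_norm_def split: if_splits)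
    then have "bourgain_image \<tau> 0 (3/8) u w" unfolding w_def by (rule someI_ex)
    then obtain v v' where
      v: "\<And>n. space_multiplier (\<lambda>k. exp (\<i> * of_int n * of_real \<tau> * (of_int k)\<^sup>2)) (u n) (v n)" and
      v': "\<And>n. space_multiplier (\<lambda>k. of_real (japanese (real_of_int k) powr 0)) (v n) (v' n)" and
      mult: "time_multiplier \<tau> (\<lambda>\<sigma>. of_real (japanese (d_sym \<tau> \<sigma>) powr (3/8))) v' w"
      by (auto simp: bourgain_image_def)
    have coeff: "fourier_coeff (v' n) k = cis (of_int n * \<tau> * (of_int k)\<^sup>2) * fourier_coeff (u n) k" for n k
    proof -
      have "japanese (real_of_int k) \<noteq> 0" using one_le_japanese[of "real_of_int k"] by auto
      then have "fourier_coeff (v' n) k = fourier_coeff (v n) k"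
        using v'[of n] by (simp add: space_multiplier_def)
      also have "\<dots> = exp (\<i> * of_int n * of_real \<tau> * (of_int k)\<^sup>2) * fourier_coeff (u n) k"
        using v[of n] by (simp add: space_multiplier_def)
      finally show ?thesis by (simp add: cis_conv_exp mult.assoc)
    qed
    have bnorm: "bourgain_norm \<tau> 0 (3/8) u = epowr (ennreal \<tau> * (\<Sum>\<^sub>\<infinity>n. L2sq (w n))) (1/2)"
      using ex by (simp add: bourgain_norm_def lp_norm_def Lp_norm_2 epowr_cancel flip: w_def)
    have "ennreal \<tau> * (\<Sum>\<^sub>\<infinity>n. L2sq (w n)) \<noteq> top"
      using fin unfolding bnorm by (auto simp: epowr_def)
    then obtain s where s: "ennreal \<tau> * (\<Sum>\<^sub>\<infinity>n. L2sq (w n)) = ennreal s" "0 \<le> s"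
      by (cases "ennreal \<tau> * (\<Sum>\<^sub>\<infinity>n. L2sq (w n))") auto
    define r where "r n = integral {-pi..pi} (\<lambda>x. norm (freq_filter chi K (u n) x) ^ 4)" for n
    have cont: "continuous_on A (\<lambda>x. norm (freq_filter chi K (u n) x) ^ 4)" for A n
      unfolding freq_filter_eq_sum[OF assms K0] by (intro continuous_intros)
    have r0: "0 \<le> r n" for n
      unfolding r_def by (intro integral_nonneg integrable_continuous_real cont) auto
    have L4: "epowr (Lp_norm 4 (freq_filter chi K (u n))) 4 = ennreal (r n)" for n
    proof -
      have "epowr (Lp_norm 4 (freq_filter chi K (u n))) 4
         = (\<integral>\<^sup>+x\<in>{-pi..pi}. ennreal (norm (freq_filter chi K (u n) x) ^ 4) \<partial>lborel)"
        by (simp add: Lp_norm_def epowr_cancel)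
      also have "\<dots> = ennreal (r n)"
        unfolding r_def by (rule set_nn_integral_continuous[OF cont]) simp
      finally show ?thesis .
    qed
    define c where "c = strichartz_const * K\<^sup>2 * (B ^ 4 * (3 * s))\<^sup>2"
    have c0: "0 \<le> c" using strichartz_const_pos by (simp add: c_def)
    have "(\<Sum>n=-int N..int N. r n) \<le> c" for N
      unfolding r_def c_def by (rule sum_integral_filter_le[OF assms B(2) tau K0 K1 coeff mult s])
    then have sum_le: "(\<Sum>\<^sub>\<infinity>n. ennreal (r n)) \<le> ennreal c"
      by (intro infsum_ennreal_le_of_symmetric_sums r0)
    have "lp_norm \<tau> 4 (\<lambda>n. Lp_norm 4 (freq_filter chi K (u n))) = epowr (ennreal \<tau> * (\<Sum>\<^sub>\<infinity>n. ennreal (r n))) (1/4)"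
      by (simp add: lp_norm_def L4)
    also have "\<dots> \<le> epowr (ennreal \<tau> * ennreal c) (1/4)"
      by (intro epowr_mono mult_left_mono sum_le) auto
    also have "\<dots> = ennreal ((\<tau> * c) powr (1/4))"
      using tau c0 by (simp add: epowr_def flip: ennreal_mult)
    also have "(\<tau> * c) powr (1/4) = C * (K * \<tau> powr (1/2)) powr (1/2) * s powr (1/2)"
    proof -
      have eq: "\<tau> * c = (9 * strichartz_const * B ^ 8) * (K * \<tau> powr (1/2)) powr 2 * s powr 2"
        using tau K0 s(2) by (simp add: c_def power_mult_distrib powr_half_sqrt power_mult[symmetric])
      show ?thesis
        unfolding eq C_def powr_mult powr_powr by simp
    qed
    also have "ennreal (C * (K * \<tau> powr (1/2)) powr (1/2) * s powr (1/2))
      = ennreal (C * (K * \<tau> powr (1/2)) powr (1/2)) * bourgain_norm \<tau> 0 (3/8) u"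
      using C s(2) by (simp add: bnorm s(1) epowr_def ennreal_mult)
    finally show "lp_norm \<tau> 4 (\<lambda>n. Lp_norm 4 (freq_filter chi K (u n)))
         \<le> ennreal (C * (K * \<tau> powr (1/2)) powr (1/2)) * bourgain_norm \<tau> 0 (3/8) u" .
  qed
qed

end
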